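(* Let $(\mathbb{D},G)$ be a data symmetry that admits least supports. Then the category whose objects are single-orbit nominal $G$-sets and whose morphisms are equivariant functions is equivalent to the category whose - objects are pairs $(C,S)$ with $C\subseteq\mathbb{D}$ finite and fungible and $S\le G|_C$; - morphisms from $(C,S)$ to $(D,T)$ are $\equiv_T$-equivalence classes of injective functions $u:D\to C$ such that $u=\pi|_D$ for some $\pi\in G$ and for every $\sigma\in S$ there is $\tau\in T$ with $\sigma\circ u=u\circ\tau$ (where $u\equiv_T v$ iff $v=u\circ\tau$ for some $\tau\in T$), with composition induced by composition of representing functions.
   Context: A data symmetry is a set $\mathbb{D}$ with a subgroup $G$ of the group of all bijections of $\mathbb{D}$. A $G$-set is a set with right $G$-action; it is nominal if each element $x$ has a finite $C\subseteq\mathbb{D}$ such that $x\cdot\pi=x$ for all $\pi\in G$ fixing $C$ pointwise (such $C$ supports $x$); single-orbit means one orbit; equivariant functions commute with the action. $(\mathbb{D},G)$ admits least supports if every element of every nominal $G$-set has a least finite support. A finite $C$ is fungible if for each $c\in C$ some $\pi\in G$ moves $c$ and fixes every element of $C\setminus\{c\}$. $G|_C=\{\pi|_C:\pi\in G,\ \pi(C)=C\}$. *)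

theory Defs
  imports "HOL-Algebra.Bij"
begin

section \<open>Categories and their equivalence\<close>

text \<open>
  Hom-sets of different pairs of objects may overlap as HOL sets, so composition and the arrow
  parts of functors take the objects involved as extra arguments:
  \<open>Comp A B C g f\<close> is the composite of \<open>f : A \<rightarrow> B\<close> followed by \<open>g : B \<rightarrow> C\<close>.
\<close>

record ('o, 'm) category =
  Ob :: "'o set"
  Hom :: "'o \<Rightarrow> 'o \<Rightarrow> 'm set"
  Id :: "'o \<Rightarrow> 'm"
  Comp :: "'o \<Rightarrow> 'o \<Rightarrow> 'o \<Rightarrow> 'm \<Rightarrow> 'm \<Rightarrow> 'm"

definition is_category :: "('o, 'm) category \<Rightarrow> bool" where
  "is_category \<C> \<longleftrightarrow>
     (\<forall>A\<in>Ob \<C>. Id \<C> A \<in> Hom \<C> A A) \<and>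
     (\<forall>A\<in>Ob \<C>. \<forall>B\<in>Ob \<C>. \<forall>C\<in>Ob \<C>. \<forall>f\<in>Hom \<C> A B. \<forall>g\<in>Hom \<C> B C.
        Comp \<C> A B C g f \<in> Hom \<C> A C) \<and>
     (\<forall>A\<in>Ob \<C>. \<forall>B\<in>Ob \<C>. \<forall>f\<in>Hom \<C> A B.
        Comp \<C> A A B f (Id \<C> A) = f \<and> Comp \<C> A B B (Id \<C> B) f = f) \<and>
     (\<forall>A\<in>Ob \<C>. \<forall>B\<in>Ob \<C>. \<forall>C\<in>Ob \<C>. \<forall>D\<in>Ob \<C>.
        \<forall>f\<in>Hom \<C> A B. \<forall>g\<in>Hom \<C> B C. \<forall>h\<in>Hom \<C> C D.
        Comp \<C> A C D h (Comp \<C> A B C g f) = Comp \<C> A B D (Comp \<C> B C D h g) f)"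

type_synonym ('o, 'm, 'p, 'n) functr = "('o \<Rightarrow> 'p) \<times> ('o \<Rightarrow> 'o \<Rightarrow> 'm \<Rightarrow> 'n)"

definition is_functor ::
  "('o, 'm) category \<Rightarrow> ('p, 'n) category \<Rightarrow> ('o, 'm, 'p, 'n) functr \<Rightarrow> bool" where
  "is_functor \<C> \<D> F \<longleftrightarrow>
     (\<forall>A\<in>Ob \<C>. fst F A \<in> Ob \<D>) \<and>
     (\<forall>A\<in>Ob \<C>. \<forall>B\<in>Ob \<C>. \<forall>f\<in>Hom \<C> A B. snd F A B f \<in> Hom \<D> (fst F A) (fst F B)) \<and>
     (\<forall>A\<in>Ob \<C>. snd F A A (Id \<C> A) = Id \<D> (fst F A)) \<and>
     (\<forall>A\<in>Ob \<C>. \<forall>B\<in>Ob \<C>. \<forall>C\<in>Ob \<C>. \<forall>f\<in>Hom \<C> A B. \<forall>g\<in>Hom \<C> B C.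
        snd F A C (Comp \<C> A B C g f) =
        Comp \<D> (fst F A) (fst F B) (fst F C) (snd F B C g) (snd F A B f))"

definition id_functor :: "('o, 'm, 'o, 'm) functr" where
  "id_functor = (\<lambda>A. A, \<lambda>A B f. f)"

definition comp_functor ::
  "('p, 'n, 'q, 'r) functr \<Rightarrow> ('o, 'm, 'p, 'n) functr \<Rightarrow> ('o, 'm, 'q, 'r) functr" where
  "comp_functor K F = (\<lambda>A. fst K (fst F A), \<lambda>A B f. snd K (fst F A) (fst F B) (snd F A B f))"

definition is_iso :: "('o, 'm) category \<Rightarrow> 'o \<Rightarrow> 'o \<Rightarrow> 'm \<Rightarrow> bool" where
  "is_iso \<C> A B f \<longleftrightarrow>
     f \<in> Hom \<C> A B \<and>
     (\<exists>g\<in>Hom \<C> B A. Comp \<C> A B A g f = Id \<C> A \<and> Comp \<C> B A B f g = Id \<C> B)"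

definition naturally_isomorphic ::
  "('o, 'm) category \<Rightarrow> ('p, 'n) category \<Rightarrow>
   ('o, 'm, 'p, 'n) functr \<Rightarrow> ('o, 'm, 'p, 'n) functr \<Rightarrow> bool" where
  "naturally_isomorphic \<C> \<D> F K \<longleftrightarrow>
     (\<exists>\<eta>. (\<forall>A\<in>Ob \<C>. is_iso \<D> (fst F A) (fst K A) (\<eta> A)) \<and>
          (\<forall>A\<in>Ob \<C>. \<forall>B\<in>Ob \<C>. \<forall>f\<in>Hom \<C> A B.
             Comp \<D> (fst F A) (fst F B) (fst K B) (\<eta> B) (snd F A B f) =
             Comp \<D> (fst F A) (fst K A) (fst K B) (snd K A B f) (\<eta> A)))"

definition equivalent_categories ::
  "('o, 'm) category \<Rightarrow> ('p, 'n) category \<Rightarrow> bool" where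
  "equivalent_categories \<C> \<D> \<longleftrightarrow>
     is_category \<C> \<and> is_category \<D> \<and>
     (\<exists>F K. is_functor \<C> \<D> F \<and> is_functor \<D> \<C> K \<and>
            naturally_isomorphic \<C> \<C> id_functor (comp_functor K F) \<and>
            naturally_isomorphic \<D> \<D> (comp_functor F K) id_functor)"


section \<open>Data symmetries and nominal sets\<close>

text \<open>
  Bijections of \<open>D\<close> are represented, as in \<open>BijGroup\<close>, by functions that are \<open>undefined\<close>
  outside \<open>D\<close>.
\<close>

definition data_symmetry :: "'d set \<Rightarrow> ('d \<Rightarrow> 'd) set \<Rightarrow> bool" where
  "data_symmetry D G \<longleftrightarrow> subgroup G (BijGroup D)"

text \<open>
  For right actions, the product of \<open>\<pi>\<close> and \<open>\<sigma>\<close> is read from left to right, first \<open>\<pi>\<close> and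
  then \<open>\<sigma>\<close> (the opposite of the multiplication of \<open>BijGroup\<close>), so that \<open>d \<cdot> \<pi> = \<pi>(d)\<close> is a
  right action on \<open>D\<close>.
\<close>

definition perm_group :: "'d set \<Rightarrow> ('d \<Rightarrow> 'd) set \<Rightarrow> ('d \<Rightarrow> 'd) monoid" where
  "perm_group D G = \<lparr>carrier = G, mult = (\<lambda>\<pi> \<sigma>. compose D \<sigma> \<pi>), one = (\<lambda>d\<in>D. d)\<rparr>"

text \<open>
  The action is extensional in both arguments, so that a \<open>G\<close>-set is determined by its carrier
  and its action on it.
\<close>

type_synonym ('x, 'd) gset = "'x set \<times> ('x \<Rightarrow> ('d \<Rightarrow> 'd) \<Rightarrow> 'x)"

definition right_action :: "('g, 'b) monoid_scheme \<Rightarrow> 'x set \<Rightarrow> ('x \<Rightarrow> 'g \<Rightarrow> 'x) \<Rightarrow> bool" where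
  "right_action H X act \<longleftrightarrow>
     act \<in> X \<rightarrow>\<^sub>E (carrier H \<rightarrow>\<^sub>E X) \<and>
     (\<forall>x\<in>X. act x \<one>\<^bsub>H\<^esub> = x) \<and>
     (\<forall>x\<in>X. \<forall>\<pi>\<in>carrier H. \<forall>\<sigma>\<in>carrier H. act x (\<pi> \<otimes>\<^bsub>H\<^esub> \<sigma>) = act (act x \<pi>) \<sigma>)"

definition is_gset :: "'d set \<Rightarrow> ('d \<Rightarrow> 'd) set \<Rightarrow> ('x, 'd) gset \<Rightarrow> bool" where
  "is_gset D G X \<longleftrightarrow> right_action (perm_group D G) (fst X) (snd X)"

definition supports ::
  "'d set \<Rightarrow> ('d \<Rightarrow> 'd) set \<Rightarrow> ('x, 'd) gset \<Rightarrow> 'd set \<Rightarrow> 'x \<Rightarrow> bool" where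
  "supports D G X C x \<longleftrightarrow>
     C \<subseteq> D \<and> finite C \<and> (\<forall>\<pi>\<in>G. (\<forall>c\<in>C. \<pi> c = c) \<longrightarrow> snd X x \<pi> = x)"

definition nominal :: "'d set \<Rightarrow> ('d \<Rightarrow> 'd) set \<Rightarrow> ('x, 'd) gset \<Rightarrow> bool" where
  "nominal D G X \<longleftrightarrow> is_gset D G X \<and> (\<forall>x\<in>fst X. \<exists>C. supports D G X C x)"

definition orbit_of :: "('d \<Rightarrow> 'd) set \<Rightarrow> ('x, 'd) gset \<Rightarrow> 'x \<Rightarrow> 'x set" where
  "orbit_of G X x = {snd X x \<pi> | \<pi>. \<pi> \<in> G}"

definition single_orbit :: "('d \<Rightarrow> 'd) set \<Rightarrow> ('x, 'd) gset \<Rightarrow> bool" where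
  "single_orbit G X \<longleftrightarrow> is_singleton (orbit_of G X ` fst X)"

definition equivariant ::
  "('d \<Rightarrow> 'd) set \<Rightarrow> ('x, 'd) gset \<Rightarrow> ('y, 'd) gset \<Rightarrow> ('x \<Rightarrow> 'y) \<Rightarrow> bool" where
  "equivariant G X Y f \<longleftrightarrow>
     f \<in> fst X \<rightarrow>\<^sub>E fst Y \<and> (\<forall>x\<in>fst X. \<forall>\<pi>\<in>G. f (snd X x \<pi>) = snd Y (f x) \<pi>)"

text \<open>
  HOL cannot quantify over all types inside a formula, so \<open>G\<close>-sets are taken with carriers in a
  type \<open>'x\<close>.  This loses nothing as soon as \<open>G\<close> embeds into \<open>'x\<close>: see
  \<open>single_orbit_copy\<close> and \<open>admits_least_supports_any_type\<close> below.
\<close>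

definition admits_least_supports :: "'x itself \<Rightarrow> 'd set \<Rightarrow> ('d \<Rightarrow> 'd) set \<Rightarrow> bool" where
  "admits_least_supports _ D G \<longleftrightarrow>
     (\<forall>X :: ('x, 'd) gset. nominal D G X \<longrightarrow>
        (\<forall>x\<in>fst X. \<exists>C. supports D G X C x \<and> (\<forall>C'. supports D G X C' x \<longrightarrow> C \<subseteq> C')))"

definition single_orbit_category ::
  "'d set \<Rightarrow> ('d \<Rightarrow> 'd) set \<Rightarrow> (('x, 'd) gset, 'x \<Rightarrow> 'x) category" where
  "single_orbit_category D G =
     \<lparr>Ob = {X. nominal D G X \<and> single_orbit G X},
      Hom = (\<lambda>X Y. {f. equivariant G X Y f}),
      Id = (\<lambda>X. \<lambda>x\<in>fst X. x),
      Comp = (\<lambda>X Y Z g f. compose (fst X) g f)\<rparr>"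


section \<open>Support representations\<close>

definition fungible :: "('d \<Rightarrow> 'd) set \<Rightarrow> 'd set \<Rightarrow> bool" where
  "fungible G C \<longleftrightarrow> (\<forall>c\<in>C. \<exists>\<pi>\<in>G. \<pi> c \<noteq> c \<and> (\<forall>d\<in>C - {c}. \<pi> d = d))"

definition restrict_group :: "('d \<Rightarrow> 'd) set \<Rightarrow> 'd set \<Rightarrow> ('d \<Rightarrow> 'd) monoid" where
  "restrict_group G C = (BijGroup C)\<lparr>carrier := {restrict \<pi> C | \<pi>. \<pi> \<in> G \<and> \<pi> ` C = C}\<rparr>"

type_synonym 'd supp_rep = "'d set \<times> ('d \<Rightarrow> 'd) set"

definition is_supp_rep :: "'d set \<Rightarrow> ('d \<Rightarrow> 'd) set \<Rightarrow> 'd supp_rep \<Rightarrow> bool" where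
  "is_supp_rep D G P \<longleftrightarrow>
     fst P \<subseteq> D \<and> finite (fst P) \<and> fungible G (fst P) \<and> subgroup (snd P) (restrict_group G (fst P))"

text \<open>
  Representatives of the morphisms from \<open>P = (C, S)\<close> to \<open>Q = (E, T)\<close>; they are functions from
  \<open>E\<close> to \<open>C\<close>, against the direction of the morphism.
\<close>

definition mor_reps ::
  "('d \<Rightarrow> 'd) set \<Rightarrow> 'd supp_rep \<Rightarrow> 'd supp_rep \<Rightarrow> ('d \<Rightarrow> 'd) set" where
  "mor_reps G P Q =
     {u \<in> fst Q \<rightarrow>\<^sub>E fst P. inj_on u (fst Q) \<and>
        (\<exists>\<pi>\<in>G. u = restrict \<pi> (fst Q)) \<and>
        (\<forall>\<sigma>\<in>snd P. \<exists>\<tau>\<in>snd Q. compose (fst Q) \<sigma> u = compose (fst Q) u \<tau>)}"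

definition mor_rel ::
  "('d \<Rightarrow> 'd) set \<Rightarrow> 'd supp_rep \<Rightarrow> 'd supp_rep \<Rightarrow> (('d \<Rightarrow> 'd) \<times> ('d \<Rightarrow> 'd)) set" where
  "mor_rel G P Q =
     {(u, v). u \<in> mor_reps G P Q \<and> v \<in> mor_reps G P Q \<and>
        (\<exists>\<tau>\<in>snd Q. v = compose (fst Q) u \<tau>)}"

text \<open>
  The composite of the classes \<open>U : P \<rightarrow> Q\<close> and \<open>V : Q \<rightarrow> R\<close> is the class of \<open>u \<circ> v\<close>, for any
  representatives \<open>u \<in> U\<close> and \<open>v \<in> V\<close>; the union runs over all choices of representatives.
\<close>

definition supp_rep_category ::
  "'d set \<Rightarrow> ('d \<Rightarrow> 'd) set \<Rightarrow> ('d supp_rep, ('d \<Rightarrow> 'd) set) category" where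
  "supp_rep_category D G =
     \<lparr>Ob = {P. is_supp_rep D G P},
      Hom = (\<lambda>P Q. mor_reps G P Q // mor_rel G P Q),
      Id = (\<lambda>P. mor_rel G P P `` {\<lambda>c\<in>fst P. c}),
      Comp = (\<lambda>P Q R V U. \<Union>u\<in>U. \<Union>v\<in>V. mor_rel G P R `` {compose (fst R) u v})\<rparr>"


section \<open>Independence of the carrier type\<close>

lemma orbit_copy:
  fixes X :: "('y, 'd) gset" and \<iota> :: "('d \<Rightarrow> 'd) \<Rightarrow> 'x"
  assumes ds: "data_symmetry D G" and inj: "inj_on \<iota> G" and nom: "nominal D G X"
    and x0: "x0 \<in> fst X"
  defines "O' \<equiv> orbit_of G X x0"
  shows "\<exists>h (Z :: ('x, 'd) gset). nominal D G Z \<and> single_orbit G Z \<and> bij_betw h O' (fst Z) \<and>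
           (\<forall>x\<in>O'. \<forall>\<pi>\<in>G. snd X x \<pi> \<in> O' \<and> h (snd X x \<pi>) = snd Z (h x) \<pi>) \<and> x0 \<in> O' \<and>
           (\<forall>x\<in>O'. \<forall>C. supports D G Z C (h x) \<longleftrightarrow> supports D G X C x)"
proof -
  obtain XX act where X: "X = (XX, act)" by (cases X)
  have sg: "subgroup G (BijGroup D)" using ds by (simp add: data_symmetry_def)
  have sub: "G \<subseteq> Bij D"
    using subgroup.subset[OF sg] by (simp add: BijGroup_def)
  have oneG: "(\<lambda>d\<in>D. d) \<in> G"
    using subgroup.one_closed[OF sg] by (simp add: BijGroup_def)
  have comG: "compose D \<sigma> \<pi> \<in> G" if "\<pi> \<in> G" "\<sigma> \<in> G" for \<pi> \<sigma>
  proof -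
    have "\<pi> \<in> Bij D" "\<sigma> \<in> Bij D" using that sub by auto
    then show ?thesis using subgroup.m_closed[OF sg that(2,1)] by (simp add: BijGroup_def)
  qed
  have invG: "\<exists>\<sigma>\<in>G. compose D \<sigma> \<pi> = (\<lambda>d\<in>D. d)" if "\<pi> \<in> G" for \<pi>
  proof -
    have "inv\<^bsub>BijGroup D\<^esub> \<pi> \<in> G" using subgroup.m_inv_closed[OF sg that] .
    moreover have "inv\<^bsub>BijGroup D\<^esub> \<pi> \<otimes>\<^bsub>BijGroup D\<^esub> \<pi> = \<one>\<^bsub>BijGroup D\<^esub>"
      using that sub by (intro group.l_inv group_BijGroup) (auto simp: BijGroup_def)
    moreover have "\<sigma> \<otimes>\<^bsub>BijGroup D\<^esub> \<pi> = compose D \<sigma> \<pi>" if "\<sigma> \<in> G" for \<sigma>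
    proof -
      have "\<pi> \<in> Bij D" "\<sigma> \<in> Bij D" using that \<open>\<pi> \<in> G\<close> sub by auto
      then show ?thesis by (simp add: BijGroup_def)
    qed
    moreover have "\<one>\<^bsub>BijGroup D\<^esub> = (\<lambda>d\<in>D. d)" by (simp add: BijGroup_def)
    ultimately show ?thesis by metis
  qed
  have A: "act \<in> XX \<rightarrow>\<^sub>E (G \<rightarrow>\<^sub>E XX)" and A1: "\<And>x. x \<in> XX \<Longrightarrow> act x (\<lambda>d\<in>D. d) = x"
    and A2: "\<And>x \<pi> \<sigma>. x \<in> XX \<Longrightarrow> \<pi> \<in> G \<Longrightarrow> \<sigma> \<in> G \<Longrightarrow> act x (compose D \<sigma> \<pi>) = act (act x \<pi>) \<sigma>"
    and N: "\<And>x. x \<in> XX \<Longrightarrow> \<exists>C. supports D G X C x"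
    using nom by (auto simp: X nominal_def is_gset_def right_action_def perm_group_def)
  have AX: "act x \<pi> \<in> XX" if "x \<in> XX" "\<pi> \<in> G" for x \<pi> using A that by (auto simp: PiE_iff)
  have O'_eq: "O' = {act x0 \<pi> | \<pi>. \<pi> \<in> G}" by (simp add: O'_def orbit_of_def X)
  have x0X: "x0 \<in> XX" using x0 by (simp add: X)
  have OX: "O' \<subseteq> XX" using AX x0X by (auto simp: O'_eq)
  have OO: "act x \<pi> \<in> O'" if "x \<in> O'" "\<pi> \<in> G" for x \<pi>
  proof -
    obtain \<rho> where "\<rho> \<in> G" "x = act x0 \<rho>" using \<open>x \<in> O'\<close> by (auto simp: O'_eq)
    then have "act x \<pi> = act x0 (compose D \<pi> \<rho>)" "compose D \<pi> \<rho> \<in> G"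
      using A2[OF x0X _ \<open>\<pi> \<in> G\<close>] comG[OF _ \<open>\<pi> \<in> G\<close>] by auto
    then show ?thesis unfolding O'_eq by blast
  qed
  have x0O: "x0 \<in> O'" using A1[OF x0X, symmetric] oneG unfolding O'_eq by blast
  define r where "r = (\<lambda>x. SOME \<pi>. \<pi> \<in> G \<and> act x0 \<pi> = x)"
  have r: "r x \<in> G \<and> act x0 (r x) = x" if "x \<in> O'" for x
  proof -
    have "\<exists>\<pi>. \<pi> \<in> G \<and> act x0 \<pi> = x" using that by (auto simp: O'_eq)
    then show ?thesis unfolding r_def by (rule someI_ex)
  qed
  define h where "h = (\<lambda>x. \<iota> (r x))"
  have injh: "inj_on h O'"
  proof (rule inj_onI)
    fix x y assume a: "x \<in> O'" "y \<in> O'" "h x = h y"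
    then have "r x = r y" using inj r by (auto simp: h_def dest: inj_onD)
    then show "x = y" using r a by metis
  qed
  define k where "k = inv_into O' h"
  have k: "k (h x) = x" if "x \<in> O'" for x using that injh by (simp add: k_def)
  define Z where "Z = (h ` O', \<lambda>z\<in>h ` O'. \<lambda>\<pi>\<in>G. h (act (k z) \<pi>))"
  have Zact: "snd Z (h x) \<pi> = h (act x \<pi>)" if "x \<in> O'" "\<pi> \<in> G" for x \<pi>
    using that k by (simp add: Z_def)
  have fZ: "fst Z = h ` O'" by (simp add: Z_def)
  have S: "supports D G Z C (h x) \<longleftrightarrow> supports D G X C x" if "x \<in> O'" for x C
  proof -
    have "snd Z (h x) \<pi> = h x \<longleftrightarrow> act x \<pi> = x" if "\<pi> \<in> G" for \<pi>
      using Zact[OF \<open>x \<in> O'\<close> that] inj_on_eq_iff[OF injh OO[OF \<open>x \<in> O'\<close> that] \<open>x \<in> O'\<close>] by simp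
    then show ?thesis unfolding supports_def X snd_conv by blast
  qed
  have gZ: "is_gset D G Z"
    unfolding is_gset_def right_action_def perm_group_def
  proof (intro conjI; simp)
    show "snd Z \<in> fst Z \<rightarrow>\<^sub>E G \<rightarrow>\<^sub>E fst Z"
      using OO k by (auto simp: Z_def)
    show "\<forall>x\<in>fst Z. snd Z x (\<lambda>d\<in>D. d) = x"
      using Zact oneG A1 OX by (auto simp: fZ subset_iff)
    show "\<forall>x\<in>fst Z. \<forall>\<pi>\<in>G. \<forall>\<sigma>\<in>G. snd Z x (compose D \<sigma> \<pi>) = snd Z (snd Z x \<pi>) \<sigma>"
      using Zact comG A2 OX OO by (auto simp: fZ subset_iff)
  qed
  have nZ: "nominal D G Z"
    unfolding nominal_def using gZ S N OX by (auto simp: fZ subset_iff)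
  have orb: "orbit_of G Z z = fst Z" if "z \<in> fst Z" for z
  proof -
    obtain \<pi> where p: "\<pi> \<in> G" "z = h (act x0 \<pi>)" "act x0 \<pi> \<in> O'"
      using \<open>z \<in> fst Z\<close> by (auto simp: fZ O'_eq)
    obtain \<pi>' where p': "\<pi>' \<in> G" "compose D \<pi>' \<pi> = (\<lambda>d\<in>D. d)" using invG[OF p(1)] by blast
    have ret: "act (act x0 \<pi>) \<pi>' = x0" using A2[OF x0X p(1) p'(1)] p'(2) A1[OF x0X] by simp
    have "h y \<in> orbit_of G Z z" if y: "y \<in> O'" for y
    proof -
      have "act (act x0 \<pi>) (compose D (r y) \<pi>') = y"
        using A2[of "act x0 \<pi>" \<pi>' "r y"] r[OF y] p' p OX ret by auto
      with comG[OF p'(1) conjunct1[OF r[OF y]]]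
      have "snd Z z (compose D (r y) \<pi>') = h y"
        using Zact[OF p(3)] by (simp add: p(2))
      moreover have "compose D (r y) \<pi>' \<in> G" using comG p'(1) r[OF y] by blast
      ultimately show ?thesis unfolding orbit_of_def by force
    qed
    moreover have "orbit_of G Z z \<subseteq> fst Z"
      using Zact OO that by (auto simp: orbit_of_def fZ)
    ultimately show ?thesis by (auto simp: fZ)
  qed
  have "single_orbit G Z"
  proof -
    have "h x0 \<in> fst Z" using x0O by (simp add: fZ)
    then have "orbit_of G Z ` fst Z = {fst Z}" using orb by blast
    then show ?thesis by (simp add: single_orbit_def)
  qed
  moreover have "bij_betw h O' (fst Z)" using injh by (simp add: bij_betw_def fZ)
  moreover have "\<forall>x\<in>O'. \<forall>\<pi>\<in>G. snd X x \<pi> \<in> O' \<and> h (snd X x \<pi>) = snd Z (h x) \<pi>"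
    using OO Zact by (simp add: X)
  ultimately show ?thesis using nZ x0O S by (intro exI[of _ h] exI[of _ Z]) simp
qed

lemma single_orbit_copy:
  fixes X :: "('y, 'd) gset" and \<iota> :: "('d \<Rightarrow> 'd) \<Rightarrow> 'x"
  assumes "data_symmetry D G" "inj_on \<iota> G" and nom: "nominal D G X" and so: "single_orbit G X"
  shows "\<exists>h (Z :: ('x, 'd) gset). nominal D G Z \<and> single_orbit G Z \<and>
           bij_betw h (fst X) (fst Z) \<and> equivariant G X Z h"
proof -
  have one: "(\<lambda>d\<in>D. d) \<in> G"
    using subgroup.one_closed[OF assms(1)[unfolded data_symmetry_def]] by (simp add: BijGroup_def)
  obtain x0 where x0: "x0 \<in> fst X" and all: "\<And>x. x \<in> fst X \<Longrightarrow> orbit_of G X x = orbit_of G X x0"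
  proof -
    obtain B where B: "orbit_of G X ` fst X = {B}"
      using so by (auto simp: single_orbit_def is_singleton_def)
    then have eq: "orbit_of G X x = B" if "x \<in> fst X" for x
      using imageI[OF that, of "orbit_of G X"] by simp
    have "fst X \<noteq> {}" using B by auto
    then obtain x0 where "x0 \<in> fst X" by blast
    then show ?thesis using eq that by simp
  qed
  have a1: "\<And>x. x \<in> fst X \<Longrightarrow> snd X x (\<lambda>d\<in>D. d) = x"
    and aX: "\<And>x \<pi>. x \<in> fst X \<Longrightarrow> \<pi> \<in> G \<Longrightarrow> snd X x \<pi> \<in> fst X"
    using nom by (auto simp: nominal_def is_gset_def right_action_def perm_group_def PiE_iff)
  have "x \<in> orbit_of G X x" if "x \<in> fst X" for x
    using a1[OF that, symmetric] one unfolding orbit_of_def by blast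
  then have "fst X \<subseteq> orbit_of G X x0" using all by blast
  moreover have "orbit_of G X x0 \<subseteq> fst X" using aX[OF x0] unfolding orbit_of_def by blast
  ultimately have O: "orbit_of G X x0 = fst X" by blast
  obtain h and Z :: "('x, 'd) gset" where *: "nominal D G Z" "single_orbit G Z"
    "bij_betw h (fst X) (fst Z)" "\<forall>x\<in>fst X. \<forall>\<pi>\<in>G. h (snd X x \<pi>) = snd Z (h x) \<pi>"
    using orbit_copy[OF assms(1-3) x0] unfolding O by (elim exE conjE) (rule that, assumption+, blast)
  have "bij_betw (restrict h (fst X)) (fst X) (fst Z)" using *(3) by simp
  moreover have "equivariant G X Z (restrict h (fst X))"
    using *(3,4) aX by (auto simp: equivariant_def bij_betw_def)
  ultimately show ?thesis using *(1,2) by (intro exI conjI)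
qed

lemma admits_least_supports_any_type:
  fixes \<iota> :: "('d \<Rightarrow> 'd) \<Rightarrow> 'x"
  assumes "data_symmetry D G" "inj_on \<iota> G" and ls: "admits_least_supports TYPE('x) D G"
  shows "admits_least_supports TYPE('y) D G"
  unfolding admits_least_supports_def
proof (intro allI impI ballI)
  fix X :: "('y, 'd) gset" and x
  assume X: "nominal D G X" "x \<in> fst X"
  obtain h and Z :: "('x, 'd) gset" where Z: "nominal D G Z" "h x \<in> fst Z"
    "\<And>C. supports D G Z C (h x) \<longleftrightarrow> supports D G X C x"
  proof -
    obtain h and Z :: "('x, 'd) gset" where *: "nominal D G Z"
      "bij_betw h (orbit_of G X x) (fst Z)" "x \<in> orbit_of G X x"
      "\<forall>y\<in>orbit_of G X x. \<forall>C. supports D G Z C (h y) \<longleftrightarrow> supports D G X C y"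
      using orbit_copy[OF assms(1,2) X] by (elim exE conjE) (rule that, assumption+)
    show ?thesis
    proof (rule that)
      show "nominal D G Z" by (rule *(1))
      show "h x \<in> fst Z" using *(2,3) by (rule bij_betw_apply)
      show "supports D G Z C (h x) \<longleftrightarrow> supports D G X C x" for C using *(3,4) by blast
    qed
  qed
  show "\<exists>C. supports D G X C x \<and> (\<forall>C'. supports D G X C' x \<longrightarrow> C \<subseteq> C')"
    using ls[unfolded admits_least_supports_def, rule_format, OF Z(1,2)] by (simp only: Z(3))
qed

end

theory Submission
  imports Defs
begin

text \<open>
  Both categories are images of the category of pointed single-orbit nominal sets \<open>(X, x)\<close> (with
  morphisms that ignore the points) under functors that are fully faithful and surjective on
  objects.  One functor forgets \<open>x\<close>.  The other takes \<open>(X, x)\<close> to the least support \<open>C\<close> of \<open>x\<close>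
  together with the restrictions to \<open>C\<close> of the stabilizer of \<open>x\<close>, and \<open>f : (X, x) \<rightarrow> (Y, y)\<close> to the
  class of all restrictions of those \<open>\<pi>\<close> for which \<open>f x = y \<cdot> \<pi>\<close>.  Leastness makes \<open>C\<close> fungible and
  invariant under the stabilizer, and forces \<open>\<pi>\<close> to map the least support of \<open>y\<close> into that of \<open>x\<close>.
  Conversely, \<open>(C, S)\<close> comes from the cosets of \<open>{\<pi> \<in> G. \<pi>|\<^sub>C \<in> S}\<close> in \<open>G\<close>, where fungibility
  makes \<open>C\<close> the least support of the base point.
\<close>

section \<open>Spans of equivalences\<close>

text \<open>The elements of \<open>B\<close> form a category that is never named: a morphism from
  \<open>a\<close> to \<open>b\<close> is one of \<open>\<C>\<close> from \<open>U a\<close> to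
  \<open>U b\<close>. The leg \<open>U\<close> is then fully faithful by construction, and
  \<open>M\<close> is the arrow part of the leg \<open>R\<close>. Only \<open>\<C>\<close> is
  assumed to be a category; for \<open>\<D>\<close> the laws are derived.\<close>

locale category_span =
  fixes \<C> :: "('o, 'm) category" and \<D> :: "('p, 'n) category" and B :: "'b set"
    and U :: "'b \<Rightarrow> 'o" and R :: "'b \<Rightarrow> 'p" and M :: "'b \<Rightarrow> 'b \<Rightarrow> 'm \<Rightarrow> 'n"
  assumes cat: "is_category \<C>"
    and U_image: "U ` B = Ob \<C>"
    and R_image: "R ` B = Ob \<D>"
    and M_bij: "\<And>a b. a \<in> B \<Longrightarrow> b \<in> B \<Longrightarrow>
          bij_betw (M a b) (Hom \<C> (U a) (U b)) (Hom \<D> (R a) (R b))"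
    and M_Id: "\<And>a. a \<in> B \<Longrightarrow> M a a (Id \<C> (U a)) = Id \<D> (R a)"
    and M_Comp: "\<And>a b c f g. a \<in> B \<Longrightarrow> b \<in> B \<Longrightarrow> c \<in> B \<Longrightarrow>
          f \<in> Hom \<C> (U a) (U b) \<Longrightarrow> g \<in> Hom \<C> (U b) (U c) \<Longrightarrow>
          M a c (Comp \<C> (U a) (U b) (U c) g f) = Comp \<D> (R a) (R b) (R c) (M b c g) (M a b f)"
begin

lemma U_Ob: "a \<in> B \<Longrightarrow> U a \<in> Ob \<C>"
  using U_image by blast

lemma R_Ob: "a \<in> B \<Longrightarrow> R a \<in> Ob \<D>"
  using R_image by blast

lemma Id_Hom: "A \<in> Ob \<C> \<Longrightarrow> Id \<C> A \<in> Hom \<C> A A"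
  using cat by (simp add: is_category_def)

lemma Comp_Hom:
  "A \<in> Ob \<C> \<Longrightarrow> A' \<in> Ob \<C> \<Longrightarrow> A'' \<in> Ob \<C> \<Longrightarrow> f \<in> Hom \<C> A A' \<Longrightarrow> g \<in> Hom \<C> A' A'' \<Longrightarrow>
   Comp \<C> A A' A'' g f \<in> Hom \<C> A A''"
  using cat by (simp add: is_category_def)

lemma Comp_Id_right:
  "A \<in> Ob \<C> \<Longrightarrow> A' \<in> Ob \<C> \<Longrightarrow> f \<in> Hom \<C> A A' \<Longrightarrow> Comp \<C> A A A' f (Id \<C> A) = f"
  using cat by (simp add: is_category_def)

lemma Comp_Id_left:
  "A \<in> Ob \<C> \<Longrightarrow> A' \<in> Ob \<C> \<Longrightarrow> f \<in> Hom \<C> A A' \<Longrightarrow> Comp \<C> A A' A' (Id \<C> A') f = f"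
  using cat by (simp add: is_category_def)

lemma Comp_assoc:
  "A \<in> Ob \<C> \<Longrightarrow> A' \<in> Ob \<C> \<Longrightarrow> A'' \<in> Ob \<C> \<Longrightarrow> A''' \<in> Ob \<C> \<Longrightarrow>
   f \<in> Hom \<C> A A' \<Longrightarrow> g \<in> Hom \<C> A' A'' \<Longrightarrow> h \<in> Hom \<C> A'' A''' \<Longrightarrow>
   Comp \<C> A A'' A''' h (Comp \<C> A A' A'' g f) = Comp \<C> A A' A''' (Comp \<C> A' A'' A''' h g) f"
  using cat unfolding is_category_def by blast

lemma M_Hom:
  "a \<in> B \<Longrightarrow> b \<in> B \<Longrightarrow> f \<in> Hom \<C> (U a) (U b) \<Longrightarrow> M a b f \<in> Hom \<D> (R a) (R b)"
  using bij_betw_apply[OF M_bij] .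

lemma M_surj:
  assumes "a \<in> B" "b \<in> B" "g \<in> Hom \<D> (R a) (R b)"
  obtains f where "f \<in> Hom \<C> (U a) (U b)" "g = M a b f"
  using bij_betw_imp_surj_on[OF M_bij[OF assms(1,2)]] assms(3) by blast

text \<open>Every object of \<open>\<D>\<close> is some \<open>R a\<close> and every arrow some
  \<open>M a b f\<close>, so each law is the image under \<open>M\<close> of the same law in
  \<open>\<C>\<close>.\<close>

lemma is_category_target: "is_category \<D>"
  unfolding is_category_def R_image[symmetric] ball_simps(9)
proof (intro conjI ballI)
  fix a assume a: "a \<in> B"
  show "Id \<D> (R a) \<in> Hom \<D> (R a) (R a)"
    using M_Hom[OF a a Id_Hom[OF U_Ob[OF a]]] M_Id[OF a] by simp
next
  fix a b c f g assume B: "a \<in> B" "b \<in> B" "c \<in> B"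
    and fg: "f \<in> Hom \<D> (R a) (R b)" "g \<in> Hom \<D> (R b) (R c)"
  obtain f' g' where f': "f' \<in> Hom \<C> (U a) (U b)" "f = M a b f'"
    and g': "g' \<in> Hom \<C> (U b) (U c)" "g = M b c g'"
    using M_surj[OF B(1,2) fg(1)] M_surj[OF B(2,3) fg(2)] by metis
  show "Comp \<D> (R a) (R b) (R c) g f \<in> Hom \<D> (R a) (R c)"
    using M_Hom[OF B(1,3) Comp_Hom[OF U_Ob[OF B(1)] U_Ob[OF B(2)] U_Ob[OF B(3)] f'(1) g'(1)]]
    by (simp add: M_Comp B f' g')
next
  fix a b f assume B: "a \<in> B" "b \<in> B" and f: "f \<in> Hom \<D> (R a) (R b)"
  obtain f' where f': "f' \<in> Hom \<C> (U a) (U b)" "f = M a b f'" using M_surj[OF B f] .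
  show "Comp \<D> (R a) (R a) (R b) f (Id \<D> (R a)) = f"
    using M_Comp[OF B(1,1,2) Id_Hom f'(1)] f' B
    by (simp add: U_Ob Comp_Id_right M_Id)
  show "Comp \<D> (R a) (R b) (R b) (Id \<D> (R b)) f = f"
    using M_Comp[OF B(1,2,2) f'(1) Id_Hom] f' B
    by (simp add: U_Ob Comp_Id_left M_Id)
next
  fix a b c d f g h assume B: "a \<in> B" "b \<in> B" "c \<in> B" "d \<in> B"
    and fgh: "f \<in> Hom \<D> (R a) (R b)" "g \<in> Hom \<D> (R b) (R c)" "h \<in> Hom \<D> (R c) (R d)"
  obtain f' g' h' where f': "f' \<in> Hom \<C> (U a) (U b)" "f = M a b f'"
    and g': "g' \<in> Hom \<C> (U b) (U c)" "g = M b c g'"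
    and h': "h' \<in> Hom \<C> (U c) (U d)" "h = M c d h'"
    using M_surj[OF B(1,2) fgh(1)] M_surj[OF B(2,3) fgh(2)] M_surj[OF B(3,4) fgh(3)] by metis
  note O = U_Ob[OF B(1)] U_Ob[OF B(2)] U_Ob[OF B(3)] U_Ob[OF B(4)]
  have "Comp \<D> (R a) (R c) (R d) h (Comp \<D> (R a) (R b) (R c) g f) =
        M a d (Comp \<C> (U a) (U c) (U d) h' (Comp \<C> (U a) (U b) (U c) g' f'))"
    using f' g' h' B by (simp add: M_Comp Comp_Hom O)
  also have "\<dots> = M a d (Comp \<C> (U a) (U b) (U d) (Comp \<C> (U b) (U c) (U d) h' g') f')"
    using f' g' h' by (simp add: Comp_assoc[OF O])
  also have "\<dots> = Comp \<D> (R a) (R b) (R d) (Comp \<D> (R b) (R c) (R d) h g) f"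
    using f' g' h' B by (simp add: M_Comp Comp_Hom O)
  finally show "Comp \<D> (R a) (R c) (R d) h (Comp \<D> (R a) (R b) (R c) g f) =
    Comp \<D> (R a) (R b) (R d) (Comp \<D> (R b) (R c) (R d) h g) f" .
qed

section \<open>Reversing a span\<close>

abbreviation M_inv :: "'b \<Rightarrow> 'b \<Rightarrow> 'n \<Rightarrow> 'm" where
  "M_inv a b \<equiv> inv_into (Hom \<C> (U a) (U b)) (M a b)"

lemma M_inv_Hom:
  "a \<in> B \<Longrightarrow> b \<in> B \<Longrightarrow> g \<in> Hom \<D> (R a) (R b) \<Longrightarrow> M_inv a b g \<in> Hom \<C> (U a) (U b)"
  using bij_betw_apply[OF bij_betw_inv_into[OF M_bij]] .

lemma M_inv_M:
  "a \<in> B \<Longrightarrow> b \<in> B \<Longrightarrow> f \<in> Hom \<C> (U a) (U b) \<Longrightarrow> M_inv a b (M a b f) = f"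
  using bij_betw_inv_into_left[OF M_bij] .

lemma M_M_inv:
  "a \<in> B \<Longrightarrow> b \<in> B \<Longrightarrow> g \<in> Hom \<D> (R a) (R b) \<Longrightarrow> M a b (M_inv a b g) = g"
  using bij_betw_inv_into_right[OF M_bij] .

text \<open>Inverting \<open>M\<close> on each hom-set exchanges the legs, so what is proved in one
  direction also holds in the other.\<close>

lemma span_swap: "category_span \<D> \<C> B R U M_inv"
proof
  show "is_category \<D>" by (rule is_category_target)
  show "R ` B = Ob \<D>" "U ` B = Ob \<C>" by (rule R_image, rule U_image)
  show "bij_betw (M_inv a b) (Hom \<D> (R a) (R b)) (Hom \<C> (U a) (U b))" if "a \<in> B" "b \<in> B" for a b
    using that by (rule bij_betw_inv_into[OF M_bij])
  show "M_inv a a (Id \<D> (R a)) = Id \<C> (U a)" if "a \<in> B" for a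
    using M_inv_M[OF that that Id_Hom[OF U_Ob[OF that]]] M_Id[OF that] by simp
  fix a b c f g assume B: "a \<in> B" "b \<in> B" "c \<in> B"
    and fg: "f \<in> Hom \<D> (R a) (R b)" "g \<in> Hom \<D> (R b) (R c)"
  obtain f' g' where f': "f' \<in> Hom \<C> (U a) (U b)" "f = M a b f'"
    and g': "g' \<in> Hom \<C> (U b) (U c)" "g = M b c g'"
    using M_surj[OF B(1,2) fg(1)] M_surj[OF B(2,3) fg(2)] by metis
  have "M_inv a c (Comp \<D> (R a) (R b) (R c) g f) =
        M_inv a c (M a c (Comp \<C> (U a) (U b) (U c) g' f'))"
    using f' g' B by (simp add: M_Comp)
  also have "\<dots> = Comp \<C> (U a) (U b) (U c) (M_inv b c g) (M_inv a b f)"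
    using f' g' B by (simp add: M_inv_M Comp_Hom U_Ob)
  finally show "M_inv a c (Comp \<D> (R a) (R b) (R c) g f) =
    Comp \<C> (U a) (U b) (U c) (M_inv b c g) (M_inv a b f)" .
qed

section \<open>Functors from choices of preimages\<close>

text \<open>Choosing a preimage \<open>s A\<close> under \<open>U\<close> for each object suffices:
  an arrow of \<open>\<C>\<close> from \<open>A\<close> to \<open>A'\<close> is already a morphism
  from \<open>s A\<close> to \<open>s A'\<close>.\<close>

definition section_functor :: "('o \<Rightarrow> 'b) \<Rightarrow> ('o, 'm, 'p, 'n) functr" where
  "section_functor s = (\<lambda>A. R (s A), \<lambda>A A' f. M (s A) (s A') f)"

lemma section_functor_is_functor:
  assumes s: "\<And>A. A \<in> Ob \<C> \<Longrightarrow> s A \<in> B" "\<And>A. A \<in> Ob \<C> \<Longrightarrow> U (s A) = A"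
  shows "is_functor \<C> \<D> (section_functor s)"
  unfolding is_functor_def section_functor_def fst_conv snd_conv
proof (intro conjI ballI)
  fix A assume A: "A \<in> Ob \<C>"
  show "R (s A) \<in> Ob \<D>" by (simp add: R_Ob s A)
  show "M (s A) (s A) (Id \<C> A) = Id \<D> (R (s A))"
    using M_Id[OF s(1)[OF A]] by (simp add: s A)
  fix A' assume A': "A' \<in> Ob \<C>"
  show "M (s A) (s A') f \<in> Hom \<D> (R (s A)) (R (s A'))" if "f \<in> Hom \<C> A A'" for f
    using M_Hom[OF s(1)[OF A] s(1)[OF A']] that by (simp add: s A A')
  fix A'' f g assume A'': "A'' \<in> Ob \<C>" and fg: "f \<in> Hom \<C> A A'" "g \<in> Hom \<C> A' A''"
  show "M (s A) (s A'') (Comp \<C> A A' A'' g f) =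
    Comp \<D> (R (s A)) (R (s A')) (R (s A'')) (M (s A') (s A'') g) (M (s A) (s A') f)"
    using M_Comp[OF s(1)[OF A] s(1)[OF A'] s(1)[OF A'']] fg by (simp add: s A A' A'')
qed

text \<open>Two elements of \<open>B\<close> over the same object of \<open>\<C>\<close> are joined
  by its identity, whose images under \<open>M\<close> in the two directions are mutually
  inverse.\<close>

lemma comparison_iso:
  assumes "a \<in> B" "b \<in> B" "U a = U b"
  shows "is_iso \<D> (R a) (R b) (M a b (Id \<C> (U a)))"
proof -
  have O: "U b \<in> Ob \<C>" and I: "Id \<C> (U b) \<in> Hom \<C> (U b) (U b)"
    using assms by (auto intro: U_Ob Id_Hom)
  have "M a b (Id \<C> (U b)) \<in> Hom \<D> (R a) (R b)" "M b a (Id \<C> (U b)) \<in> Hom \<D> (R b) (R a)"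
    using M_Hom[of a b "Id \<C> (U b)"] M_Hom[of b a "Id \<C> (U b)"] assms I by auto
  moreover have "Comp \<D> (R a) (R b) (R a) (M b a (Id \<C> (U b))) (M a b (Id \<C> (U b))) = Id \<D> (R a)"
    using M_Comp[of a b a "Id \<C> (U b)" "Id \<C> (U b)"] M_Id[of a] assms I O
    by (simp add: Comp_Id_right)
  moreover have "Comp \<D> (R b) (R a) (R b) (M a b (Id \<C> (U b))) (M b a (Id \<C> (U b))) = Id \<D> (R b)"
    using M_Comp[of b a b "Id \<C> (U b)" "Id \<C> (U b)"] M_Id[of b] assms I O
    by (simp add: Comp_Id_right)
  ultimately show ?thesis unfolding is_iso_def assms(3) by blast
qed

text \<open>Both composites equal \<open>M a b' f\<close>, by absorbing an identity on the left or
  on the right.\<close>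

lemma comparison_natural:
  assumes B: "a \<in> B" "b \<in> B" "a' \<in> B" "b' \<in> B" and eq: "U a = U b" "U a' = U b'"
    and f: "f \<in> Hom \<C> (U b) (U b')"
  shows "Comp \<D> (R a) (R a') (R b') (M a' b' (Id \<C> (U a'))) (M a a' f) =
         Comp \<D> (R a) (R b) (R b') (M b b' f) (M a b (Id \<C> (U a)))"
proof -
  have O: "U b \<in> Ob \<C>" "U b' \<in> Ob \<C>" using B by (auto intro: U_Ob)
  have "M a b' f = Comp \<D> (R a) (R a') (R b') (M a' b' (Id \<C> (U b'))) (M a a' f)"
    using M_Comp[of a a' b' f "Id \<C> (U b')"] assms O by (simp add: Comp_Id_left Id_Hom)
  moreover have "M a b' f = Comp \<D> (R a) (R b) (R b') (M b b' f) (M a b (Id \<C> (U b)))"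
    using M_Comp[of a b b' "Id \<C> (U b)" f] assms O by (simp add: Comp_Id_right Id_Hom)
  ultimately show ?thesis by (simp add: eq)
qed

text \<open>The round trip replaces \<open>t P\<close> by \<open>s (U (t P))\<close>, which lies
  over the same object of \<open>\<C>\<close>, so the comparison arrows form the natural
  isomorphism. Both directions are recorded because the second one is applied to the swapped span.
  The functor back is written out, being a section functor of that swapped span.\<close>

lemma section_functors_inverse:
  assumes s: "\<And>A. A \<in> Ob \<C> \<Longrightarrow> s A \<in> B" "\<And>A. A \<in> Ob \<C> \<Longrightarrow> U (s A) = A"
    and t: "\<And>P. P \<in> Ob \<D> \<Longrightarrow> t P \<in> B" "\<And>P. P \<in> Ob \<D> \<Longrightarrow> R (t P) = P"
  defines "FK \<equiv> comp_functor (section_functor s) (\<lambda>P. U (t P), \<lambda>P Q g. M_inv (t P) (t Q) g)"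
  shows "naturally_isomorphic \<D> \<D> FK id_functor" and "naturally_isomorphic \<D> \<D> id_functor FK"
proof -
  define a where "a = (\<lambda>P. s (U (t P)))"
  have a: "a P \<in> B" "U (a P) = U (t P)" if "P \<in> Ob \<D>" for P
    using that by (simp_all add: a_def s t U_Ob)
  have FK: "fst FK P = R (a P)" "snd FK P Q g = M (a P) (a Q) (M_inv (t P) (t Q) g)" for P Q g
    by (simp_all add: FK_def comp_functor_def section_functor_def a_def)
  have inv: "M_inv (t P) (t Q) g \<in> Hom \<C> (U (t P)) (U (t Q))"
    "M (t P) (t Q) (M_inv (t P) (t Q) g) = g"
    if "P \<in> Ob \<D>" "Q \<in> Ob \<D>" "g \<in> Hom \<D> P Q" for P Q g
    using M_inv_Hom[of "t P" "t Q" g] M_M_inv[of "t P" "t Q" g] that by (simp_all add: t)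
  show "naturally_isomorphic \<D> \<D> FK id_functor"
    unfolding naturally_isomorphic_def id_functor_def FK fst_conv snd_conv
  proof (intro exI conjI ballI)
    fix P assume P: "P \<in> Ob \<D>"
    show "is_iso \<D> (R (a P)) P (M (a P) (t P) (Id \<C> (U (a P))))"
      using comparison_iso[of "a P" "t P"] P by (simp add: a t)
    fix Q g assume "Q \<in> Ob \<D>" "g \<in> Hom \<D> P Q"
    then show "Comp \<D> (R (a P)) (R (a Q)) Q (M (a Q) (t Q) (Id \<C> (U (a Q))))
        (M (a P) (a Q) (M_inv (t P) (t Q) g)) =
      Comp \<D> (R (a P)) P Q g (M (a P) (t P) (Id \<C> (U (a P))))"
      using comparison_natural[of "a P" "t P" "a Q" "t Q" "M_inv (t P) (t Q) g"] inv[of P Q g] P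
      by (simp add: a t)
  qed
  show "naturally_isomorphic \<D> \<D> id_functor FK"
    unfolding naturally_isomorphic_def id_functor_def FK fst_conv snd_conv
  proof (intro exI conjI ballI)
    fix P assume P: "P \<in> Ob \<D>"
    show "is_iso \<D> P (R (a P)) (M (t P) (a P) (Id \<C> (U (t P))))"
      using comparison_iso[of "t P" "a P"] P by (simp add: a t)
    fix Q g assume "Q \<in> Ob \<D>" "g \<in> Hom \<D> P Q"
    then show "Comp \<D> P Q (R (a Q)) (M (t Q) (a Q) (Id \<C> (U (t Q)))) g =
      Comp \<D> P (R (a P)) (R (a Q)) (M (a P) (a Q) (M_inv (t P) (t Q) g))
        (M (t P) (a P) (Id \<C> (U (t P))))"
      using comparison_natural[of "t P" "a P" "t Q" "a Q" "M_inv (t P) (t Q) g"] inv[of P Q g] P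
      by (simp add: a t)
  qed
qed

theorem span_equivalent: "equivalent_categories \<C> \<D>"
proof -
  interpret op: category_span \<D> \<C> B R U M_inv by (rule span_swap)
  define s where "s = inv_into B U"
  define t where "t = inv_into B R"
  have s: "s A \<in> B" "U (s A) = A" if "A \<in> Ob \<C>" for A
    using that unfolding s_def U_image[symmetric] by (simp_all add: inv_into_into f_inv_into_f)
  have t: "t P \<in> B" "R (t P) = P" if "P \<in> Ob \<D>" for P
    using that unfolding t_def R_image[symmetric] by (simp_all add: inv_into_into f_inv_into_f)
  define F where "F = section_functor s"
  define K where "K = op.section_functor t"
  have K': "K = (\<lambda>P. U (t P), \<lambda>P Q g. M_inv (t P) (t Q) g)"
    by (simp add: K_def op.section_functor_def)
  \<comment> \<open>For the swapped span the round trip is phrased with the inverse of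
    \<open>M_inv\<close>. This agrees with \<open>M\<close> on hom-sets but perhaps not elsewhere,
    so \<open>F'\<close> has to be compared with \<open>F\<close> there.\<close>
  define F' :: "('o, 'm, 'p, 'n) functr"
    where "F' = (\<lambda>A. R (s A), \<lambda>A A' f. op.M_inv (s A) (s A') f)"
  have F': "fst F' = fst F" "\<And>A A' f. A \<in> Ob \<C> \<Longrightarrow> A' \<in> Ob \<C> \<Longrightarrow> f \<in> Hom \<C> A A' \<Longrightarrow> snd F' A A' f = snd F A A' f"
  proof -
    show "fst F' = fst F" by (simp add: F'_def F_def section_functor_def)
    fix A A' f assume A: "A \<in> Ob \<C>" "A' \<in> Ob \<C>" "f \<in> Hom \<C> A A'"
    have "M_inv (s A) (s A') (M (s A) (s A') f) = f" "M (s A) (s A') f \<in> Hom \<D> (R (s A)) (R (s A'))"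
      using M_inv_M[of "s A" "s A'" f] M_Hom[of "s A" "s A'" f] A by (simp_all add: s)
    then have "op.M_inv (s A) (s A') f = M (s A) (s A') f"
      using op.M_inv_M[of "s A" "s A'" "M (s A) (s A') f"] A by (simp add: s)
    then show "snd F' A A' f = snd F A A' f" by (simp add: F'_def F_def section_functor_def)
  qed
  have "naturally_isomorphic \<C> \<C> id_functor (comp_functor K F')"
    using op.section_functors_inverse(2)[of t s] s t unfolding K_def F'_def by simp
  then have "naturally_isomorphic \<C> \<C> id_functor (comp_functor K F)"
    unfolding naturally_isomorphic_def comp_functor_def fst_conv snd_conv F'(1)
    by (elim exE, intro exI) (simp add: F'(2))
  moreover have "naturally_isomorphic \<D> \<D> (comp_functor F K) id_functor"
    using section_functors_inverse(1)[of s t] s t unfolding K' F_def by simp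
  moreover have "is_functor \<C> \<D> F" "is_functor \<D> \<C> K"
    unfolding F_def K_def using s t
    by (simp_all add: section_functor_is_functor op.section_functor_is_functor)
  ultimately show ?thesis
    unfolding equivalent_categories_def using cat is_category_target by blast
qed

end


section \<open>Group actions of a data symmetry\<close>

locale symmetry =
  fixes D :: "'d set" and G :: "('d \<Rightarrow> 'd) set"
  assumes data_symmetry: "data_symmetry D G"
begin

lemma subgroup_G: "subgroup G (BijGroup D)"
  using data_symmetry by (simp add: data_symmetry_def)

lemma G_Bij: "\<pi> \<in> G \<Longrightarrow> \<pi> \<in> Bij D"
  using subgroup.subset[OF subgroup_G] by (auto simp: BijGroup_def)

lemma G_bij_betw: "\<pi> \<in> G \<Longrightarrow> bij_betw \<pi> D D"
  using G_Bij by (simp add: Bij_def)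

lemma G_extensional: "\<pi> \<in> G \<Longrightarrow> \<pi> \<in> extensional D"
  using G_Bij by (simp add: Bij_def)

lemma G_in_D: "\<pi> \<in> G \<Longrightarrow> d \<in> D \<Longrightarrow> \<pi> d \<in> D"
  using bij_betw_apply[OF G_bij_betw] .

lemma G_inj: "\<pi> \<in> G \<Longrightarrow> C \<subseteq> D \<Longrightarrow> inj_on \<pi> C"
  using bij_betw_imp_inj_on[OF G_bij_betw] inj_on_subset by blast

lemma G_one: "(\<lambda>d\<in>D. d) \<in> G"
  using subgroup.one_closed[OF subgroup_G] by (simp add: BijGroup_def)

lemma G_compose: "\<pi> \<in> G \<Longrightarrow> \<sigma> \<in> G \<Longrightarrow> compose D \<sigma> \<pi> \<in> G"
  using subgroup.m_closed[OF subgroup_G, of \<sigma> \<pi>] by (simp add: BijGroup_def G_Bij)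

lemma G_ext: "\<pi> \<in> G \<Longrightarrow> \<sigma> \<in> G \<Longrightarrow> (\<And>d. d \<in> D \<Longrightarrow> \<pi> d = \<sigma> d) \<Longrightarrow> \<pi> = \<sigma>"
  using extensionalityI[OF G_extensional G_extensional] .

text \<open>The inverse in \<open>BijGroup D\<close>, made explicit so that it can be evaluated at
  points.\<close>

definition ginv :: "('d \<Rightarrow> 'd) \<Rightarrow> 'd \<Rightarrow> 'd" where
  "ginv \<pi> = (\<lambda>d\<in>D. inv_into D \<pi> d)"

lemma G_ginv: "\<pi> \<in> G \<Longrightarrow> ginv \<pi> \<in> G"
  using subgroup.m_inv_closed[OF subgroup_G, of \<pi>] by (simp add: inv_BijGroup G_Bij ginv_def)

lemma ginv_left: "\<pi> \<in> G \<Longrightarrow> d \<in> D \<Longrightarrow> ginv \<pi> (\<pi> d) = d"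
  using bij_betw_inv_into_left[OF G_bij_betw] by (simp add: ginv_def G_in_D)

lemma ginv_right: "\<pi> \<in> G \<Longrightarrow> d \<in> D \<Longrightarrow> \<pi> (ginv \<pi> d) = d"
  using bij_betw_inv_into_right[OF G_bij_betw] by (simp add: ginv_def)

lemma compose_ginv: "\<pi> \<in> G \<Longrightarrow> compose D (ginv \<pi>) \<pi> = (\<lambda>d\<in>D. d)"
  by (rule G_ext) (simp_all add: G_compose G_ginv G_one compose_eq ginv_left)

lemma compose_ginv_cancel:
  "\<pi> \<in> G \<Longrightarrow> \<rho> \<in> G \<Longrightarrow> compose D \<rho> (compose D (ginv \<rho>) \<pi>) = \<pi>"
  by (rule G_ext) (simp_all add: G_compose G_ginv compose_eq ginv_right G_in_D)

section \<open>Actions and supports\<close>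

context
  fixes X :: "('x, 'd) gset"
  assumes gset: "is_gset D G X"
begin

lemma act_closed: "x \<in> fst X \<Longrightarrow> \<pi> \<in> G \<Longrightarrow> snd X x \<pi> \<in> fst X"
  using gset by (auto simp: is_gset_def right_action_def perm_group_def PiE_iff)

lemma act_one: "x \<in> fst X \<Longrightarrow> snd X x (\<lambda>d\<in>D. d) = x"
  using gset by (auto simp: is_gset_def right_action_def perm_group_def)

lemma act_compose:
  "x \<in> fst X \<Longrightarrow> \<pi> \<in> G \<Longrightarrow> \<sigma> \<in> G \<Longrightarrow> snd X x (compose D \<sigma> \<pi>) = snd X (snd X x \<pi>) \<sigma>"
  using gset by (auto simp: is_gset_def right_action_def perm_group_def)

lemma act_ginv: "x \<in> fst X \<Longrightarrow> \<pi> \<in> G \<Longrightarrow> snd X (snd X x \<pi>) (ginv \<pi>) = x"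
  by (metis act_compose act_one compose_ginv G_ginv)

lemma act_eq_iff:
  assumes "x \<in> fst X" "\<pi> \<in> G" "\<rho> \<in> G"
  shows "snd X x \<pi> = snd X x \<rho> \<longleftrightarrow> snd X x (compose D (ginv \<rho>) \<pi>) = x"
proof
  assume "snd X x \<pi> = snd X x \<rho>"
  then show "snd X x (compose D (ginv \<rho>) \<pi>) = x"
    using assms by (simp add: act_compose G_ginv act_ginv)
next
  assume "snd X x (compose D (ginv \<rho>) \<pi>) = x"
  \<comment> \<open>The stabilizing element followed by \<open>\<rho>\<close> is
    \<open>\<pi>\<close>; acting in two stages, the first factor leaves \<open>x\<close>
    alone.\<close>
  then have "snd X x \<rho> = snd X x (compose D \<rho> (compose D (ginv \<rho>) \<pi>))"
    using assms by (simp add: act_compose[of _ "compose D (ginv \<rho>) \<pi>"] G_compose G_ginv)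
  then show "snd X x \<pi> = snd X x \<rho>" using assms by (simp add: compose_ginv_cancel)
qed

text \<open>\<open>\<pi>\<close> followed by the inverse of \<open>\<rho>\<close> fixes
  \<open>C\<close> pointwise and so stabilizes \<open>x\<close>. The action on \<open>x\<close> thus
  depends only on restrictions to a support.\<close>

lemma supports_act_eq:
  assumes x: "x \<in> fst X" and "supports D G X C x" "\<pi> \<in> G" "\<rho> \<in> G" "\<And>c. c \<in> C \<Longrightarrow> \<pi> c = \<rho> c"
  shows "snd X x \<pi> = snd X x \<rho>"
proof -
  have "C \<subseteq> D" using assms by (simp add: supports_def)
  then have "\<forall>c\<in>C. compose D (ginv \<rho>) \<pi> c = c"
    using assms by (auto simp: compose_eq ginv_left)
  then show ?thesis
    using assms by (simp add: act_eq_iff supports_def G_compose G_ginv)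
qed

text \<open>If \<open>\<sigma>\<close> fixes the image of \<open>C\<close> pointwise, then
  \<open>\<pi>\<close> with and without a subsequent \<open>\<sigma>\<close> agree on
  \<open>C\<close>, and \<open>supports_act_eq\<close> applies.\<close>

lemma supports_act:
  assumes x: "x \<in> fst X" and C: "supports D G X C x" and \<pi>: "\<pi> \<in> G"
  shows "supports D G X (\<pi> ` C) (snd X x \<pi>)"
  unfolding supports_def
proof (intro conjI ballI impI)
  have CD: "C \<subseteq> D" "finite C" using C by (simp_all add: supports_def)
  then show "\<pi> ` C \<subseteq> D" "finite (\<pi> ` C)" using G_in_D[OF \<pi>] by auto
  fix \<sigma> assume \<sigma>: "\<sigma> \<in> G" "\<forall>c\<in>\<pi> ` C. \<sigma> c = c"
  have "snd X x (compose D \<sigma> \<pi>) = snd X x \<pi>"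
    using \<sigma> CD by (intro supports_act_eq[OF x C] G_compose \<pi>) (auto simp: compose_eq)
  then show "snd X (snd X x \<pi>) \<sigma> = snd X x \<pi>" by (simp add: act_compose x \<pi> \<sigma>)
qed

end

lemma nominal_gset: "nominal D G X \<Longrightarrow> is_gset D G X"
  by (simp add: nominal_def)

lemma single_orbit_transitive:
  assumes X: "is_gset D G X" "single_orbit G X" and xy: "x \<in> fst X" "y \<in> fst X"
  obtains \<pi> where "\<pi> \<in> G" "y = snd X x \<pi>"
proof -
  obtain O' where "orbit_of G X ` fst X = {O'}"
    using X(2) by (auto simp: single_orbit_def is_singleton_def)
  then have "orbit_of G X y = orbit_of G X x" using xy by (metis image_eqI singletonD)
  moreover have "y \<in> orbit_of G X y"
    using act_one[OF X(1) xy(2), symmetric] G_one unfolding orbit_of_def by blast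
  ultimately show ?thesis using that unfolding orbit_of_def by blast
qed

section \<open>The category of single-orbit nominal sets\<close>

lemma is_category_single_orbit_category:
  "is_category (single_orbit_category D G :: (('x, 'd) gset, 'x \<Rightarrow> 'x) category)"
proof -
  \<comment> \<open>\<open>compose B h g\<close> is \<open>undefined\<close> outside
    \<open>B\<close>, so the composites agree because \<open>f\<close> maps \<open>A\<close> into
    \<open>B\<close>.\<close>
  have assoc: "compose A h (compose A g f) = compose A (compose B h g) f"
    if "f \<in> A \<rightarrow>\<^sub>E B" for f :: "'x \<Rightarrow> 'x" and g h A B
    using that by (auto simp: compose_def fun_eq_iff)
  have id: "equivariant G X X (\<lambda>x\<in>fst X. x)" if "nominal D G X" for X :: "('x, 'd) gset"
    by (simp add: equivariant_def act_closed nominal_gset that)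
  have *: "equivariant G X Z (compose (fst X) g f)"
    if "is_gset D G X" "equivariant G X Y f" "equivariant G Y Z g"
    for X Y Z :: "('x, 'd) gset" and f g
    using that unfolding equivariant_def
    by (auto simp: compose_eq act_closed PiE_iff Pi_iff)
  show ?thesis
    unfolding is_category_def single_orbit_category_def category.simps
  proof (intro conjI ballI)
    show "(\<lambda>x\<in>fst X. x) \<in> {f. equivariant G X X f}"
      if "X \<in> {X. nominal D G X \<and> single_orbit G X}" for X :: "('x, 'd) gset"
      using id that by blast
  next
    show "compose (fst X) g f \<in> {f. equivariant G X Z f}"
      if "X \<in> {X. nominal D G X \<and> single_orbit G X}" "f \<in> {f. equivariant G X Y f}"
        "g \<in> {f. equivariant G Y Z f}" for X Y Z :: "('x, 'd) gset" and f g
      using * nominal_gset that by blast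
  next
    show "compose (fst X) f (\<lambda>x\<in>fst X. x) = f" "compose (fst X) (\<lambda>x\<in>fst Y. x) f = f"
      if "f \<in> {f. equivariant G X Y f}" for X Y :: "('x, 'd) gset" and f
      using that by (auto simp: equivariant_def compose_def fun_eq_iff PiE_iff extensional_def)
  next
    show "compose (fst X) h (compose (fst X) g f) = compose (fst X) (compose (fst Y) h g) f"
      if "f \<in> {f. equivariant G X Y f}" for X Y :: "('x, 'd) gset" and f g h
      using that by (intro assoc) (simp add: equivariant_def)
  qed
qed

text \<open>
  The intersection is a support only when \<open>x\<close> has a least support.
\<close>

definition lsupp :: "('x, 'd) gset \<Rightarrow> 'x \<Rightarrow> 'd set" where
  "lsupp X x = \<Inter>{C. supports D G X C x}"

definition stab_rep :: "('x, 'd) gset \<Rightarrow> 'x \<Rightarrow> 'd supp_rep" where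
  "stab_rep X x = (lsupp X x, {restrict \<pi> (lsupp X x) | \<pi>. \<pi> \<in> G \<and> snd X x \<pi> = x})"

text \<open>Taking all restrictions at once avoids choosing a representative;
  \<open>arrow_class\<close> shows that they form one class. They are defined on the least support
  of \<open>y\<close> and go to that of \<open>x\<close>, against the direction of
  \<open>f\<close>.\<close>

definition arrow ::
  "('x, 'd) gset \<Rightarrow> 'x \<Rightarrow> ('x, 'd) gset \<Rightarrow> 'x \<Rightarrow> ('x \<Rightarrow> 'x) \<Rightarrow> ('d \<Rightarrow> 'd) set" where
  "arrow X x Y y f = {restrict \<pi> (lsupp Y y) | \<pi>. \<pi> \<in> G \<and> f x = snd Y y \<pi>}"

definition pointed :: "('x, 'd) gset \<times> 'x \<Rightarrow> bool" where
  "pointed a \<longleftrightarrow> nominal D G (fst a) \<and> single_orbit G (fst a) \<and> snd a \<in> fst (fst a)"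

lemma lsupp_subset: "supports D G X C x \<Longrightarrow> lsupp X x \<subseteq> C"
  by (auto simp: lsupp_def)

section \<open>Groups of restrictions\<close>

text \<open>Inverses in \<open>BijGroup C\<close> come from inverses in \<open>G\<close>, so closure
  under inverses can be checked in \<open>G\<close>.\<close>

lemma inv_restrict:
  assumes C: "C \<subseteq> D" and \<pi>: "\<pi> \<in> G" "\<pi> ` C = C"
  shows "restrict \<pi> C \<in> Bij C" "ginv \<pi> ` C = C" "inv\<^bsub>BijGroup C\<^esub> (restrict \<pi> C) = restrict (ginv \<pi>) C"
proof -
  show bij: "restrict \<pi> C \<in> Bij C"
    using \<pi> G_inj[OF \<pi>(1) C] by (auto simp: Bij_def bij_betw_def inj_on_restrict_eq)
  have "ginv \<pi> ` C = ginv \<pi> ` (\<pi> ` C)" by (simp add: \<pi>(2))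
  also have "\<dots> = C" using C by (force simp: image_image ginv_left \<pi>(1) subset_iff)
  finally show im: "ginv \<pi> ` C = C" .
  have "inv_into C (restrict \<pi> C) c = ginv \<pi> c" if "c \<in> C" for c
  proof -
    have "ginv \<pi> c \<in> C" "restrict \<pi> C (ginv \<pi> c) = c"
      using im that C by (auto simp: ginv_right \<pi>(1))
    then show ?thesis
      using bij by (metis Bij_def IntD2 mem_Collect_eq bij_betw_inv_into_left)
  qed
  then show "inv\<^bsub>BijGroup C\<^esub> (restrict \<pi> C) = restrict (ginv \<pi>) C"
    unfolding inv_BijGroup[OF bij] by (auto simp: fun_eq_iff)
qed

lemma restrict_compose:
  assumes "C \<subseteq> D" "\<pi> ` C = C"
  shows "compose C (restrict \<sigma> C) (restrict \<pi> C) = restrict (compose D \<sigma> \<pi>) C"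
  using assms by (auto simp: compose_def restrict_def fun_eq_iff)

text \<open>Used with \<open>K\<close> the setwise stabilizer of \<open>C\<close>, which gives the
  group of all restrictions, and with \<open>K\<close> the stabilizer of a point whose least support
  is \<open>C\<close>.\<close>

lemma subgroup_restrict:
  assumes C: "C \<subseteq> D" and K: "K \<subseteq> G" "\<And>\<pi>. \<pi> \<in> K \<Longrightarrow> \<pi> ` C = C" "(\<lambda>d\<in>D. d) \<in> K"
    and comp: "\<And>\<pi> \<sigma>. \<pi> \<in> K \<Longrightarrow> \<sigma> \<in> K \<Longrightarrow> compose D \<sigma> \<pi> \<in> K"
    and inv: "\<And>\<pi>. \<pi> \<in> K \<Longrightarrow> ginv \<pi> \<in> K"
  shows "subgroup {restrict \<pi> C | \<pi>. \<pi> \<in> K} (BijGroup C)"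
proof (rule group.subgroupI[OF group_BijGroup])
  have bij: "restrict \<pi> C \<in> Bij C" if "\<pi> \<in> K" for \<pi>
    using inv_restrict(1)[OF C] K that by blast
  show "{restrict \<pi> C | \<pi>. \<pi> \<in> K} \<subseteq> carrier (BijGroup C)" using bij by (auto simp: BijGroup_def)
  show "{restrict \<pi> C | \<pi>. \<pi> \<in> K} \<noteq> {}" using K(3) by blast
  show "inv\<^bsub>BijGroup C\<^esub> u \<in> {restrict \<pi> C | \<pi>. \<pi> \<in> K}" if u: "u \<in> {restrict \<pi> C | \<pi>. \<pi> \<in> K}" for u
  proof -
    obtain \<pi> where "u = restrict \<pi> C" "\<pi> \<in> K" using u by blast
    then have "inv\<^bsub>BijGroup C\<^esub> u = restrict (ginv \<pi>) C" using inv_restrict(3)[OF C] K by blast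
    then show ?thesis using inv[OF \<open>\<pi> \<in> K\<close>] by blast
  qed
  show "u \<otimes>\<^bsub>BijGroup C\<^esub> v \<in> {restrict \<pi> C | \<pi>. \<pi> \<in> K}"
    if uv: "u \<in> {restrict \<pi> C | \<pi>. \<pi> \<in> K}" "v \<in> {restrict \<pi> C | \<pi>. \<pi> \<in> K}" for u v
  proof -
    obtain \<pi> \<sigma> where *: "u = restrict \<sigma> C" "\<sigma> \<in> K" "v = restrict \<pi> C" "\<pi> \<in> K" using uv by blast
    then have "u \<otimes>\<^bsub>BijGroup C\<^esub> v = restrict (compose D \<sigma> \<pi>) C"
      using bij restrict_compose[OF C K(2)] by (simp add: BijGroup_def)
    then show ?thesis using comp * by blast
  qed
qed

lemma subgroup_restrict_group:
  assumes "C \<subseteq> D"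
  shows "subgroup {restrict \<pi> C | \<pi>. \<pi> \<in> G \<and> \<pi> ` C = C} (BijGroup C)"
proof -
  have "(\<lambda>d\<in>D. d) ` C = C" using assms by (auto simp: image_iff)
  moreover have "compose D \<sigma> \<pi> ` C = C" if "\<pi> ` C = C" "\<sigma> ` C = C" for \<sigma> \<pi>
  proof -
    have "compose D \<sigma> \<pi> ` C = \<sigma> ` \<pi> ` C"
      unfolding image_image using assms by (intro image_cong) (auto simp: compose_eq)
    then show ?thesis by (simp only: that)
  qed
  ultimately have "subgroup {restrict \<pi> C | \<pi>. \<pi> \<in> {\<pi> \<in> G. \<pi> ` C = C}} (BijGroup C)"
    using assms by (intro subgroup_restrict) (auto simp: G_one G_compose G_ginv inv_restrict(2))
  then show ?thesis by (simp only: mem_Collect_eq)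
qed

text \<open>Since the carrier of \<open>restrict_group G C\<close> is itself a subgroup of
  \<open>BijGroup C\<close>, being a subgroup can be tested in the larger group.\<close>

lemma subgroup_restrict_group_iff:
  assumes "C \<subseteq> D"
  shows "subgroup S (restrict_group G C) \<longleftrightarrow>
    subgroup S (BijGroup C) \<and> S \<subseteq> {restrict \<pi> C | \<pi>. \<pi> \<in> G \<and> \<pi> ` C = C}"
proof
  let ?H = "{restrict \<pi> C | \<pi>. \<pi> \<in> G \<and> \<pi> ` C = C}"
  assume S: "subgroup S (restrict_group G C)"
  then show "subgroup S (BijGroup C) \<and> S \<subseteq> ?H"
    using group.incl_subgroup[OF group_BijGroup subgroup_restrict_group[OF assms]]
      subgroup.subset[OF S] by (simp add: restrict_group_def)
next
  assume "subgroup S (BijGroup C) \<and> S \<subseteq> {restrict \<pi> C | \<pi>. \<pi> \<in> G \<and> \<pi> ` C = C}"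
  then show "subgroup S (restrict_group G C)"
    unfolding restrict_group_def
    using group.subgroup_incl[OF group_BijGroup _ subgroup_restrict_group[OF assms]] by blast
qed

section \<open>Coset spaces\<close>

text \<open>The elements are those of \<open>H\<close> followed by \<open>\<pi>\<close>, so in the
  multiplication of \<open>perm_group\<close> this is a right coset of \<open>H\<close>.\<close>

definition coset :: "('d \<Rightarrow> 'd) set \<Rightarrow> ('d \<Rightarrow> 'd) \<Rightarrow> ('d \<Rightarrow> 'd) set" where
  "coset H \<pi> = compose D \<pi> ` H"

text \<open>The action takes images of sets, so its definition involves no representatives.\<close>

definition coset_gset :: "('d \<Rightarrow> 'd) set \<Rightarrow> (('d \<Rightarrow> 'd) set, 'd) gset" where
  "coset_gset H = (coset H ` G, \<lambda>A\<in>coset H ` G. \<lambda>\<sigma>\<in>G. compose D \<sigma> ` A)"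

lemma compose_D_assoc:
  "\<pi> \<in> G \<Longrightarrow> \<sigma> \<in> G \<Longrightarrow> \<rho> \<in> G \<Longrightarrow> compose D \<rho> (compose D \<sigma> \<pi>) = compose D (compose D \<rho> \<sigma>) \<pi>"
  by (rule G_ext) (simp_all add: G_compose compose_eq G_in_D)

lemma compose_D_one: "\<pi> \<in> G \<Longrightarrow> compose D \<pi> (\<lambda>d\<in>D. d) = \<pi>" "\<pi> \<in> G \<Longrightarrow> compose D (\<lambda>d\<in>D. d) \<pi> = \<pi>"
  by (rule G_ext; simp add: G_compose G_one compose_eq G_in_D)+

lemma coset_gset_act:
  assumes "H \<subseteq> G" "\<pi> \<in> G" "\<sigma> \<in> G"
  shows "snd (coset_gset H) (coset H \<pi>) \<sigma> = coset H (compose D \<sigma> \<pi>)"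
  using assms by (auto simp: coset_gset_def coset_def image_image compose_D_assoc subset_iff)

lemma is_gset_coset_gset:
  assumes H: "H \<subseteq> G"
  shows "is_gset D G (coset_gset H)"
  unfolding is_gset_def right_action_def
proof (intro conjI ballI; simp add: perm_group_def)
  have F: "fst (coset_gset H) = coset H ` G" by (simp add: coset_gset_def)
  have "snd (coset_gset H) A \<sigma> \<in> coset H ` G" if "A \<in> coset H ` G" "\<sigma> \<in> G" for A \<sigma>
    using that by (auto simp: coset_gset_act H G_compose)
  then show "snd (coset_gset H) \<in> fst (coset_gset H) \<rightarrow>\<^sub>E G \<rightarrow>\<^sub>E fst (coset_gset H)"
    by (auto simp: coset_gset_def)
  fix A assume "A \<in> fst (coset_gset H)"
  then obtain \<pi> where A: "\<pi> \<in> G" "A = coset H \<pi>" by (auto simp: F)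
  show "snd (coset_gset H) A (\<lambda>d\<in>D. d) = A"
    by (simp add: A coset_gset_act H G_one compose_D_one)
  show "snd (coset_gset H) A (compose D \<rho> \<sigma>) = snd (coset_gset H) (snd (coset_gset H) A \<sigma>) \<rho>"
    if "\<sigma> \<in> G" "\<rho> \<in> G" for \<sigma> \<rho>
    using that by (simp add: A coset_gset_act H G_compose compose_D_assoc)
qed

end

section \<open>Pointed single-orbit nominal sets\<close>

text \<open>The embedding \<open>\<iota>\<close> serves to copy coset spaces, whose elements are
  sets of permutations, to carriers in \<open>'x\<close>.\<close>

locale least_support_symmetry = symmetry D G
  for D :: "'d set" and G :: "('d \<Rightarrow> 'd) set" +
  fixes \<iota> :: "('d \<Rightarrow> 'd) \<Rightarrow> 'x"
  assumes inj: "inj_on \<iota> G"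
    and least_supports: "admits_least_supports TYPE('x) D G"
begin

text \<open>A least support is a support contained in all others, hence equal to their
  intersection.\<close>

lemma supports_lsupp:
  fixes X :: "('x, 'd) gset"
  assumes "nominal D G X" "x \<in> fst X"
  shows "supports D G X (lsupp X x) x"
proof -
  obtain C where C: "supports D G X C x" "\<forall>C'. supports D G X C' x \<longrightarrow> C \<subseteq> C'"
    using least_supports assms unfolding admits_least_supports_def by blast
  then have "lsupp X x = C" unfolding lsupp_def by blast
  with C show ?thesis by simp
qed

section \<open>Least support and stabilizer of a point\<close>

context
  fixes X :: "('x, 'd) gset" and x :: 'x
  assumes nominal: "nominal D G X" and x: "x \<in> fst X"
begin

lemma lsupp_finite: "finite (lsupp X x)" and lsupp_D: "lsupp X x \<subseteq> D"
  using supports_lsupp[OF nominal x] by (simp_all add: supports_def)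

text \<open>The inverse of \<open>\<pi>\<close> carries a support of the moved point back to a
  support of \<open>x\<close>, which contains the least one.\<close>

lemma lsupp_act_subset:
  assumes "\<pi> \<in> G" "supports D G X C (snd X x \<pi>)"
  shows "\<pi> ` lsupp X x \<subseteq> C"
proof -
  note gset = nominal_gset[OF nominal]
  have CD: "C \<subseteq> D" using assms by (simp add: supports_def)
  have "supports D G X (ginv \<pi> ` C) x"
    using supports_act[OF gset _ assms(2) G_ginv[OF assms(1)]] assms x
    by (simp add: act_closed[OF gset] act_ginv[OF gset])
  then have "lsupp X x \<subseteq> ginv \<pi> ` C" by (rule lsupp_subset)
  then show ?thesis using CD ginv_right[OF assms(1)] by fastforce
qed

text \<open>Leastness gives one inclusion, and an injective map of a finite set into itself is
  onto.\<close>

lemma stabilizer_image: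
  assumes "\<pi> \<in> G" "snd X x \<pi> = x"
  shows "\<pi> ` lsupp X x = lsupp X x"
  using lsupp_act_subset[OF assms(1)] supports_lsupp[OF nominal x] G_inj[OF assms(1) lsupp_D]
  by (simp add: assms(2) endo_inj_surj lsupp_finite)

text \<open>The source of the relation \<open>mor_rel\<close>. In one direction
  \<open>\<tau>\<close> is the restriction of \<open>\<pi>\<close> followed by the inverse of
  \<open>\<rho>\<close>; in the other, \<open>\<pi>\<close> agrees on a support with a stabilizing
  element followed by \<open>\<rho>\<close>.\<close>

lemma act_eq_iff_restrict:
  assumes "\<pi> \<in> G" "\<rho> \<in> G"
  shows "snd X x \<pi> = snd X x \<rho> \<longleftrightarrow>
    (\<exists>\<tau>\<in>snd (stab_rep X x). restrict \<pi> (lsupp X x) = compose (lsupp X x) \<rho> \<tau>)"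
proof
  note gset = nominal_gset[OF nominal]
  let ?\<psi> = "compose D (ginv \<rho>) \<pi>"
  assume "snd X x \<pi> = snd X x \<rho>"
  then have "snd X x ?\<psi> = x" using act_eq_iff[OF gset x] assms by blast
  then have "restrict ?\<psi> (lsupp X x) \<in> snd (stab_rep X x)"
    using assms G_compose G_ginv by (auto simp: stab_rep_def)
  moreover have "restrict \<pi> (lsupp X x) = compose (lsupp X x) \<rho> (restrict ?\<psi> (lsupp X x))"
    using lsupp_D assms by (auto simp: fun_eq_iff compose_def restrict_def ginv_right G_in_D subset_iff)
  ultimately show "\<exists>\<tau>\<in>snd (stab_rep X x). restrict \<pi> (lsupp X x) = compose (lsupp X x) \<rho> \<tau>" by blast
next
  note gset = nominal_gset[OF nominal]
  assume "\<exists>\<tau>\<in>snd (stab_rep X x). restrict \<pi> (lsupp X x) = compose (lsupp X x) \<rho> \<tau>"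
  then obtain \<psi> where \<psi>: "\<psi> \<in> G" "snd X x \<psi> = x"
    and eq: "restrict \<pi> (lsupp X x) = compose (lsupp X x) \<rho> (restrict \<psi> (lsupp X x))"
    by (auto simp: stab_rep_def)
  have "\<pi> c = compose D \<rho> \<psi> c" if "c \<in> lsupp X x" for c
    using fun_cong[OF eq, of c] that lsupp_D by (auto simp: compose_eq)
  then have "snd X x \<pi> = snd X x (compose D \<rho> \<psi>)"
    using supports_act_eq[OF gset x supports_lsupp[OF nominal x]] assms \<psi> G_compose by blast
  then show "snd X x \<pi> = snd X x \<rho>" using \<psi> assms by (simp add: act_compose[OF gset x])
qed

text \<open>This lets a permutation and its restriction to the least support be interchanged in
  composites with \<open>\<tau>\<close>.\<close>

lemma stab_rep_maps: "\<tau> \<in> snd (stab_rep X x) \<Longrightarrow> c \<in> lsupp X x \<Longrightarrow> \<tau> c \<in> lsupp X x"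
  by (auto simp: stab_rep_def) (use stabilizer_image in blast)

text \<open>If every permutation fixing the other elements also fixed \<open>c\<close>, those other
  elements would already support \<open>x\<close>, against leastness.\<close>

lemma fungible_lsupp: "fungible G (lsupp X x)"
  unfolding fungible_def
proof (rule ballI, rule ccontr)
  fix c assume c: "c \<in> lsupp X x"
    and no: "\<not> (\<exists>\<pi>\<in>G. \<pi> c \<noteq> c \<and> (\<forall>d\<in>lsupp X x - {c}. \<pi> d = d))"
  have "supports D G X (lsupp X x - {c}) x"
    unfolding supports_def
  proof (intro conjI ballI impI)
    show "lsupp X x - {c} \<subseteq> D" "finite (lsupp X x - {c})"
      using lsupp_D lsupp_finite by auto
    fix \<pi> assume \<pi>: "\<pi> \<in> G" "\<forall>d\<in>lsupp X x - {c}. \<pi> d = d"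
    then have "\<forall>d\<in>lsupp X x. \<pi> d = d" using no by blast
    then show "snd X x \<pi> = x"
      using supports_lsupp[OF nominal x] \<pi>(1) by (simp add: supports_def)
  qed
  then show False using lsupp_subset[of X "lsupp X x - {c}" x] c by blast
qed

lemma is_supp_rep_stab_rep: "is_supp_rep D G (stab_rep X x)"
proof -
  note gset = nominal_gset[OF nominal]
  let ?K = "{\<pi> \<in> G. snd X x \<pi> = x}"
  have "subgroup {restrict \<pi> (lsupp X x) | \<pi>. \<pi> \<in> ?K} (BijGroup (lsupp X x))"
  proof (rule subgroup_restrict[OF lsupp_D])
    show "ginv \<pi> \<in> ?K" if "\<pi> \<in> ?K" for \<pi>
      using that act_ginv[OF gset x, of \<pi>] by (simp add: G_ginv)
  qed (auto simp: stabilizer_image G_one G_compose act_one[OF gset] act_compose[OF gset] x)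
  moreover have "{restrict \<pi> (lsupp X x) | \<pi>. \<pi> \<in> ?K} \<subseteq>
      {restrict \<pi> (lsupp X x) | \<pi>. \<pi> \<in> G \<and> \<pi> ` lsupp X x = lsupp X x}"
    using stabilizer_image by blast
  ultimately show ?thesis
    using lsupp_D lsupp_finite fungible_lsupp
    by (simp add: is_supp_rep_def stab_rep_def subgroup_restrict_group_iff)
qed

end

section \<open>Morphisms between two pointed sets\<close>

context
  fixes X Y :: "('x, 'd) gset" and x y :: 'x
  assumes pX: "pointed (X, x)" and pY: "pointed (Y, y)"
begin

lemma pointed_facts:
  "nominal D G X" "single_orbit G X" "x \<in> fst X" "nominal D G Y" "single_orbit G Y" "y \<in> fst Y"
  "is_gset D G X" "is_gset D G Y"
  using pX pY by (auto simp: pointed_def nominal_gset)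

lemma arrow_subset_mor_reps:
  assumes f: "equivariant G X Y f"
  shows "arrow X x Y y f \<subseteq> mor_reps G (stab_rep X x) (stab_rep Y y)"
proof
  note [simp] = pointed_facts
  fix u assume "u \<in> arrow X x Y y f"
  then obtain \<pi> where \<pi>: "u = restrict \<pi> (lsupp Y y)" "\<pi> \<in> G" "f x = snd Y y \<pi>"
    by (auto simp: arrow_def)
  \<comment> \<open>By equivariance a support of \<open>x\<close> supports \<open>f x\<close>, which
    is \<open>y\<close> moved by \<open>\<pi>\<close>; leastness at \<open>y\<close> then confines
    the image under \<open>\<pi>\<close>.\<close>
  have "supports D G Y (lsupp X x) (f x)"
    using supports_lsupp[of X x] f by (simp add: supports_def equivariant_def) (metis pointed_facts(3))
  then have im: "\<pi> ` lsupp Y y \<subseteq> lsupp X x"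
    using lsupp_act_subset[of Y y \<pi>] \<pi> by simp
  have "\<exists>\<tau>\<in>snd (stab_rep Y y). compose (lsupp Y y) \<sigma> u = compose (lsupp Y y) u \<tau>"
    if \<sigma>: "\<sigma> \<in> snd (stab_rep X x)" for \<sigma>
  proof -
    obtain \<psi> where \<psi>: "\<psi> \<in> G" "snd X x \<psi> = x" "\<sigma> = restrict \<psi> (lsupp X x)"
      using \<sigma> by (auto simp: stab_rep_def)
    \<comment> \<open>As \<open>\<psi>\<close> stabilizes \<open>x\<close>, it stabilizes
      \<open>f x\<close>. So \<open>\<pi>\<close> with and without a subsequent
      \<open>\<psi>\<close> acts alike on \<open>y\<close>, and \<open>act_eq_iff_restrict\<close>
      yields \<open>\<tau>\<close>.\<close>
    have "snd Y y (compose D \<psi> \<pi>) = snd Y (f x) \<psi>"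
      by (simp add: act_compose[of Y] \<pi> \<psi>)
    also have "\<dots> = snd Y y \<pi>" using f \<psi> \<pi> by (metis equivariant_def pointed_facts(3))
    finally obtain \<tau> where \<tau>: "\<tau> \<in> snd (stab_rep Y y)"
      and eq: "restrict (compose D \<psi> \<pi>) (lsupp Y y) = compose (lsupp Y y) \<pi> \<tau>"
      using act_eq_iff_restrict[of Y y "compose D \<psi> \<pi>" \<pi>] \<psi> \<pi> by (auto simp: G_compose)
    have "compose (lsupp Y y) \<sigma> u = restrict (compose D \<psi> \<pi>) (lsupp Y y)"
      using im lsupp_D[of Y y] \<psi>(3) \<pi>(1) by (auto simp: fun_eq_iff compose_def restrict_def)
    also have "\<dots> = compose (lsupp Y y) u \<tau>"
      unfolding eq using stab_rep_maps[of Y y, OF _ _ \<tau>] by (auto simp: \<pi>(1) fun_eq_iff compose_def)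
    finally show ?thesis using \<tau> by blast
  qed
  then show "u \<in> mor_reps G (stab_rep X x) (stab_rep Y y)"
    using im \<pi> G_inj[of \<pi> "lsupp Y y"] lsupp_D[of Y y]
    by (auto simp: mor_reps_def stab_rep_def inj_on_restrict_eq)
qed

text \<open>The members come from exactly the permutations that take \<open>y\<close> to
  \<open>f x\<close>. By \<open>act_eq_iff_restrict\<close>, the restrictions of these differ by an
  element of \<open>snd (stab_rep Y y)\<close>.\<close>

lemma arrow_class:
  assumes f: "equivariant G X Y f" and u: "u \<in> arrow X x Y y f"
  shows "arrow X x Y y f = mor_rel G (stab_rep X x) (stab_rep Y y) `` {u}"
proof -
  note [simp] = pointed_facts
  have F: "fst (stab_rep Y y) = lsupp Y y" by (simp add: stab_rep_def)
  obtain \<pi> where \<pi>: "u = restrict \<pi> (lsupp Y y)" "\<pi> \<in> G" "f x = snd Y y \<pi>"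
    using u by (auto simp: arrow_def)
  have *: "compose (lsupp Y y) u \<tau> = compose (lsupp Y y) \<pi> \<tau>" if "\<tau> \<in> snd (stab_rep Y y)" for \<tau>
    using stab_rep_maps[of Y y, OF _ _ that] by (auto simp: \<pi>(1) fun_eq_iff compose_def)
  have "v \<in> arrow X x Y y f \<longleftrightarrow>
      v \<in> mor_reps G (stab_rep X x) (stab_rep Y y) \<and>
      (\<exists>\<tau>\<in>snd (stab_rep Y y). v = compose (lsupp Y y) u \<tau>)" (is "?L \<longleftrightarrow> ?R") for v
  proof
    assume L: ?L
    then obtain \<rho> where \<rho>: "v = restrict \<rho> (lsupp Y y)" "\<rho> \<in> G" "f x = snd Y y \<rho>"
      by (auto simp: arrow_def)
    then show ?R
      using L arrow_subset_mor_reps[OF f] act_eq_iff_restrict[of Y y \<rho> \<pi>] \<pi> * by auto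
  next
    assume R: ?R
    then obtain \<rho> where \<rho>: "v = restrict \<rho> (lsupp Y y)" "\<rho> \<in> G"
      by (auto simp: mor_reps_def F)
    then have "snd Y y \<rho> = snd Y y \<pi>"
      using R act_eq_iff_restrict[of Y y \<rho> \<pi>] \<pi> * by auto
    then show ?L using \<rho> \<pi> by (auto simp: arrow_def)
  qed
  then show ?thesis
    using u arrow_subset_mor_reps[OF f] by (auto simp: mor_rel_def F)
qed

lemma arrow_nonempty:
  assumes "equivariant G X Y f"
  obtains u where "u \<in> arrow X x Y y f"
proof -
  have "f x \<in> fst Y" using assms pointed_facts by (auto simp: equivariant_def)
  then obtain \<pi> where "\<pi> \<in> G" "f x = snd Y y \<pi>"
    using single_orbit_transitive pointed_facts by metis
  then show ?thesis using that by (auto simp: arrow_def)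
qed

text \<open>A common member forces \<open>f x = g x\<close>, because a restriction to a support
  determines the action on \<open>y\<close>; equivariance spreads the equality over the orbit of
  \<open>x\<close>.\<close>

lemma arrow_inj:
  assumes f: "equivariant G X Y f" and g: "equivariant G X Y g"
    and eq: "arrow X x Y y f = arrow X x Y y g"
  shows "f = g"
proof -
  note [simp] = pointed_facts
  obtain u where u: "u \<in> arrow X x Y y f" using arrow_nonempty[OF f] .
  obtain \<pi> where \<pi>: "\<pi> \<in> G" "u = restrict \<pi> (lsupp Y y)" "f x = snd Y y \<pi>"
    using u by (auto simp: arrow_def)
  obtain \<rho> where \<rho>: "\<rho> \<in> G" "u = restrict \<rho> (lsupp Y y)" "g x = snd Y y \<rho>"
    using u unfolding eq by (auto simp: arrow_def)
  have "\<pi> c = \<rho> c" if "c \<in> lsupp Y y" for c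
    using fun_cong[OF \<pi>(2), of c] fun_cong[OF \<rho>(2), of c] that by simp
  then have "snd Y y \<pi> = snd Y y \<rho>"
    using \<pi>(1) \<rho>(1) by (intro supports_act_eq[of Y y "lsupp Y y"] supports_lsupp) simp_all
  then have fg: "f x = g x" using \<pi> \<rho> by simp
  have "f z = g z" if "z \<in> fst X" for z
  proof -
    obtain \<sigma> where "\<sigma> \<in> G" "z = snd X x \<sigma>"
      using single_orbit_transitive[OF pointed_facts(7,2,3) \<open>z \<in> fst X\<close>] .
    then show ?thesis using f g fg by (simp add: equivariant_def)
  qed
  then show ?thesis
    using f g by (auto simp: equivariant_def intro: PiE_ext)
qed

text \<open>The only candidate sends \<open>x\<close> moved by \<open>\<rho>\<close> to
  \<open>y\<close> moved first by \<open>\<pi>\<close> and then by \<open>\<rho>\<close>. The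
  compatibility condition in \<open>mor_reps\<close> makes this well defined.\<close>

lemma arrow_full:
  assumes u: "u \<in> mor_reps G (stab_rep X x) (stab_rep Y y)"
  obtains f where "equivariant G X Y f" "u \<in> arrow X x Y y f"
proof -
  note [simp] = pointed_facts
  have F: "fst (stab_rep Z z) = lsupp Z z" for Z :: "('x, 'd) gset" and z by (simp add: stab_rep_def)
  obtain \<pi> where \<pi>: "\<pi> \<in> G" "u = restrict \<pi> (lsupp Y y)" using u by (auto simp: mor_reps_def F)
  have im: "u c \<in> lsupp X x" if "c \<in> lsupp Y y" for c
    using u that by (auto simp: mor_reps_def F)
  \<comment> \<open>Equality at \<open>x\<close> makes \<open>\<rho>\<close> agree with
    \<open>\<rho>'\<close> after some \<open>\<sigma>\<close> on the least support of
    \<open>x\<close>. The condition on \<open>u\<close> trades \<open>\<sigma>\<close> for a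
    \<open>\<tau>\<close> from the stabilizer of \<open>y\<close>, which does not affect the action
    on \<open>y\<close>.\<close>
  have wd: "snd Y y (compose D \<rho> \<pi>) = snd Y y (compose D \<rho>' \<pi>)"
    if \<rho>: "\<rho> \<in> G" "\<rho>' \<in> G" "snd X x \<rho> = snd X x \<rho>'" for \<rho> \<rho>'
  proof -
    obtain \<sigma> where \<sigma>: "\<sigma> \<in> snd (stab_rep X x)"
      "restrict \<rho> (lsupp X x) = compose (lsupp X x) \<rho>' \<sigma>"
      using \<rho> act_eq_iff_restrict[of X x \<rho> \<rho>'] by auto
    obtain \<tau> where \<tau>: "\<tau> \<in> snd (stab_rep Y y)"
      "compose (lsupp Y y) \<sigma> u = compose (lsupp Y y) u \<tau>"
      using u \<sigma>(1) by (auto simp: mor_reps_def F)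
    have "compose D \<rho> \<pi> c = compose D \<rho>' \<pi> (\<tau> c)" if c: "c \<in> lsupp Y y" for c
    proof -
      have \<tau>c: "\<tau> c \<in> lsupp Y y" using stab_rep_maps[of Y y, OF _ _ \<tau>(1) c] by simp
      have "c \<in> D" "\<tau> c \<in> D" using lsupp_D[of Y y] c \<tau>c by auto
      moreover have "\<rho> (u c) = \<rho>' (\<sigma> (u c))"
        using fun_cong[OF \<sigma>(2), of "u c"] im[OF c] by (simp add: compose_eq)
      moreover have "\<sigma> (u c) = u (\<tau> c)" using fun_cong[OF \<tau>(2), of c] c by (simp add: compose_eq)
      ultimately show ?thesis using c \<tau>c by (simp add: \<pi>(2) compose_eq)
    qed
    then have "restrict (compose D \<rho> \<pi>) (lsupp Y y) = compose (lsupp Y y) (compose D \<rho>' \<pi>) \<tau>"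
      by (auto simp: fun_eq_iff compose_def[of "lsupp Y y"])
    then show ?thesis
      using act_eq_iff_restrict[of Y y "compose D \<rho> \<pi>" "compose D \<rho>' \<pi>"] \<tau>(1) \<rho> \<pi>(1)
      by (auto simp: G_compose)
  qed
  \<comment> \<open>An arbitrary permutation taking \<open>x\<close> to \<open>z\<close>; by
    \<open>wd\<close> the choice does not influence \<open>f\<close>.\<close>
  define p where "p z = (SOME \<rho>. \<rho> \<in> G \<and> snd X x \<rho> = z)" for z
  have p: "p z \<in> G \<and> snd X x (p z) = z" if z: "z \<in> fst X" for z
  proof -
    obtain \<rho> where "\<rho> \<in> G" "z = snd X x \<rho>"
      using single_orbit_transitive[OF pointed_facts(7,2,3) z] .
    then have "\<rho> \<in> G \<and> snd X x \<rho> = z" by simp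
    then show ?thesis unfolding p_def by (rule someI[of "\<lambda>\<rho>. \<rho> \<in> G \<and> snd X x \<rho> = z"])
  qed
  define f where "f = (\<lambda>z\<in>fst X. snd Y y (compose D (p z) \<pi>))"
  have f: "f (snd X x \<rho>) = snd Y y (compose D \<rho> \<pi>)" if "\<rho> \<in> G" for \<rho>
  proof -
    have z: "snd X x \<rho> \<in> fst X" using that by (simp add: act_closed)
    then show ?thesis using wd[of "p (snd X x \<rho>)" \<rho>] p[OF z] that by (simp add: f_def)
  qed
  have "equivariant G X Y f"
    unfolding equivariant_def
  proof (intro conjI ballI)
    show "f \<in> fst X \<rightarrow>\<^sub>E fst Y" using p \<pi> by (auto simp: f_def act_closed G_compose)
    fix z \<sigma> assume z: "z \<in> fst X" and \<sigma>: "\<sigma> \<in> G"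
    obtain \<rho> where \<rho>: "\<rho> \<in> G" "z = snd X x \<rho>" using p[OF z] by metis
    have "f (snd X z \<sigma>) = f (snd X x (compose D \<sigma> \<rho>))" using \<rho> \<sigma> by (simp add: act_compose[of X])
    also have "\<dots> = snd Y y (compose D \<sigma> (compose D \<rho> \<pi>))"
      using \<rho> \<sigma> \<pi> by (simp add: f G_compose compose_D_assoc)
    also have "\<dots> = snd Y (f z) \<sigma>" using \<rho> \<sigma> \<pi> by (simp add: f G_compose act_compose[of Y])
    finally show "f (snd X z \<sigma>) = snd Y (f z) \<sigma>" .
  qed
  moreover have "f x = snd Y y \<pi>"
    using f[OF G_one] \<pi> by (simp add: act_one[of X] compose_D_one)
  then have "u \<in> arrow X x Y y f" using \<pi> by (auto simp: arrow_def)
  ultimately show ?thesis by (rule that)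
qed

end

text \<open>Every class is reached because \<open>arrow_full\<close> realizes one of its members and
  \<open>arrow_class\<close> then yields all of them.\<close>

lemma arrow_bij_betw:
  fixes X Y :: "('x, 'd) gset"
  assumes "pointed (X, x)" "pointed (Y, y)"
  defines "P \<equiv> stab_rep X x" and "Q \<equiv> stab_rep Y y"
  shows "bij_betw (arrow X x Y y) {f. equivariant G X Y f} (mor_reps G P Q // mor_rel G P Q)"
  unfolding bij_betw_def
proof (intro conjI equalityI subsetI)
  note p = assms(1,2)
  show "inj_on (arrow X x Y y) {f. equivariant G X Y f}"
    using arrow_inj[OF p] by (auto intro: inj_onI)
  fix U
  show "U \<in> mor_reps G P Q // mor_rel G P Q" if U: "U \<in> arrow X x Y y ` {f. equivariant G X Y f}"
  proof -
    obtain f where f: "equivariant G X Y f" "U = arrow X x Y y f" using U by blast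
    obtain u where u: "u \<in> arrow X x Y y f" using arrow_nonempty[OF p f(1)] .
    then have "u \<in> mor_reps G P Q"
      using arrow_subset_mor_reps[OF p f(1)] unfolding P_def Q_def by blast
    then show ?thesis
      unfolding f(2) arrow_class[OF p f(1) u] P_def Q_def by (rule quotientI)
  qed
  show "U \<in> arrow X x Y y ` {f. equivariant G X Y f}" if U: "U \<in> mor_reps G P Q // mor_rel G P Q"
  proof -
    obtain u where u: "u \<in> mor_reps G P Q" "U = mor_rel G P Q `` {u}" using U by (rule quotientE)
    obtain f where f: "equivariant G X Y f" "u \<in> arrow X x Y y f"
      using arrow_full[OF p] u(1) unfolding P_def Q_def by blast
    then have "U = arrow X x Y y f" using arrow_class[OF p f] u(2) by (simp add: P_def Q_def)
    then show ?thesis using f(1) by blast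
  qed
qed

lemma arrow_Id:
  fixes X :: "('x, 'd) gset"
  assumes p: "pointed (X, x)"
  shows "arrow X x X x (\<lambda>x\<in>fst X. x) =
    mor_rel G (stab_rep X x) (stab_rep X x) `` {\<lambda>c\<in>fst (stab_rep X x). c}"
proof -
  note [simp] = pointed_facts[OF p p]
  have e: "equivariant G X X (\<lambda>x\<in>fst X. x)" by (auto simp: equivariant_def act_closed)
  have "(\<lambda>x\<in>fst X. x) x = snd X x (\<lambda>d\<in>D. d)" by (simp add: act_one)
  then have "restrict (\<lambda>d\<in>D. d) (lsupp X x) \<in> arrow X x X x (\<lambda>x\<in>fst X. x)"
    unfolding arrow_def using G_one by blast
  moreover have "restrict (\<lambda>d\<in>D. d) (lsupp X x) = (\<lambda>c\<in>fst (stab_rep X x). c)"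
    using lsupp_D[of X x] by (auto simp: stab_rep_def restrict_def fun_eq_iff)
  ultimately show ?thesis using arrow_class[OF p p e] by simp
qed

text \<open>If \<open>\<pi>\<close> takes \<open>y\<close> to \<open>f x\<close> and
  \<open>\<rho>\<close> takes \<open>z\<close> to \<open>g y\<close>, then \<open>\<rho>\<close>
  followed by \<open>\<pi>\<close> takes \<open>z\<close> to \<open>g (f x)\<close>, and it
  restricts to \<open>u\<close> after \<open>v\<close>. All choices of \<open>u\<close> and
  \<open>v\<close> thus give the same class.\<close>

lemma arrow_compose:
  fixes X Y Z :: "('x, 'd) gset"
  assumes p: "pointed (X, x)" "pointed (Y, y)" "pointed (Z, z)"
    and f: "equivariant G X Y f" and g: "equivariant G Y Z g"
  shows "arrow X x Z z (compose (fst X) g f) =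
    (\<Union>u\<in>arrow X x Y y f. \<Union>v\<in>arrow Y y Z z g.
       mor_rel G (stab_rep X x) (stab_rep Z z) `` {compose (fst (stab_rep Z z)) u v})"
proof -
  note [simp] = pointed_facts[OF p(1,2)] pointed_facts[OF p(2,3)]
  have gf: "equivariant G X Z (compose (fst X) g f)"
    using f g by (auto simp: equivariant_def compose_eq act_closed PiE_iff Pi_iff)
  have "arrow X x Z z (compose (fst X) g f) =
      mor_rel G (stab_rep X x) (stab_rep Z z) `` {compose (fst (stab_rep Z z)) u v}"
    if u: "u \<in> arrow X x Y y f" and v: "v \<in> arrow Y y Z z g" for u v
  proof (rule arrow_class[OF p(1,3) gf])
    obtain \<pi> where \<pi>: "u = restrict \<pi> (lsupp Y y)" "\<pi> \<in> G" "f x = snd Y y \<pi>"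
      using u by (auto simp: arrow_def)
    obtain \<rho> where \<rho>: "v = restrict \<rho> (lsupp Z z)" "\<rho> \<in> G" "g y = snd Z z \<rho>"
      using v by (auto simp: arrow_def)
    have "v \<in> lsupp Z z \<rightarrow>\<^sub>E lsupp Y y"
      using arrow_subset_mor_reps[OF p(2,3) g] v by (auto simp: mor_reps_def stab_rep_def)
    then have "compose (fst (stab_rep Z z)) u v = restrict (compose D \<pi> \<rho>) (lsupp Z z)"
      using lsupp_D[of Z z] by (auto simp: stab_rep_def fun_eq_iff compose_def \<pi>(1) \<rho>(1))
    moreover have "compose (fst X) g f x = snd Z z (compose D \<pi> \<rho>)"
      using g \<pi> \<rho> by (simp add: compose_eq equivariant_def act_compose[of Z])
    ultimately show "compose (fst (stab_rep Z z)) u v \<in> arrow X x Z z (compose (fst X) g f)"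
      using G_compose[OF \<rho>(2) \<pi>(2)] by (auto simp: arrow_def)
  qed
  \<comment> \<open>The union is the common class only if some pair of representatives
    exists.\<close>
  moreover obtain u v where "u \<in> arrow X x Y y f" "v \<in> arrow Y y Z z g"
    using arrow_nonempty[OF p(1,2) f] arrow_nonempty[OF p(2,3) g] by metis
  ultimately show ?thesis by blast
qed

section \<open>Realizing a support representation\<close>

lemma stab_rep_surj:
  assumes P: "is_supp_rep D G P"
  obtains X :: "('x, 'd) gset" and x where "pointed (X, x)" "stab_rep X x = P"
proof -
  obtain C S where CS: "P = (C, S)" by (cases P)
  have C: "C \<subseteq> D" "finite C" "fungible G C"
    and S: "subgroup S (BijGroup C)" "S \<subseteq> {restrict \<pi> C | \<pi>. \<pi> \<in> G \<and> \<pi> ` C = C}"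
    using P by (auto simp: is_supp_rep_def CS subgroup_restrict_group_iff)
  \<comment> \<open>The full preimage of \<open>S\<close>. It contains all permutations fixing
    \<open>C\<close> pointwise, so that \<open>C\<close> will support the base coset.\<close>
  define H where "H = {\<pi> \<in> G. restrict \<pi> C \<in> S}"
  have HG: "H \<subseteq> G" by (simp add: H_def)
  have im: "\<pi> ` C = C" if \<pi>: "\<pi> \<in> H" for \<pi>
  proof -
    obtain \<rho> where "restrict \<pi> C = restrict \<rho> C" "\<rho> ` C = C" using \<pi> S(2) by (auto simp: H_def)
    then show ?thesis by (metis image_restrict_eq)
  qed
  have one: "(\<lambda>d\<in>D. d) \<in> H"
  proof -
    have "restrict (\<lambda>d\<in>D. d) C = \<one>\<^bsub>BijGroup C\<^esub>"
      using C by (auto simp: BijGroup_def restrict_def fun_eq_iff)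
    then show ?thesis using subgroup.one_closed[OF S(1)] by (simp add: H_def G_one)
  qed
  have comp: "compose D \<sigma> \<pi> \<in> H" if H: "\<pi> \<in> H" "\<sigma> \<in> H" for \<pi> \<sigma>
  proof -
    have "restrict \<sigma> C \<otimes>\<^bsub>BijGroup C\<^esub> restrict \<pi> C \<in> S"
      using subgroup.m_closed[OF S(1)] H by (simp add: H_def)
    moreover have "restrict \<sigma> C \<otimes>\<^bsub>BijGroup C\<^esub> restrict \<pi> C = restrict (compose D \<sigma> \<pi>) C"
    proof -
      have "restrict \<sigma> C \<in> Bij C" "restrict \<pi> C \<in> Bij C"
        using inv_restrict(1)[OF C(1)] im H HG by blast+
      then show ?thesis by (simp only: BijGroup_def monoid.simps restrict_apply split if_True
            restrict_compose[OF C(1) im[OF H(1)]])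
    qed
    ultimately show ?thesis using H by (simp add: H_def G_compose)
  qed
  let ?Q = "coset_gset H"
  \<comment> \<open>The base coset, which is \<open>H\<close> itself and has \<open>H\<close> as its
    stabilizer.\<close>
  let ?q = "coset H (\<lambda>d\<in>D. d)"
  have q: "?q \<in> fst ?Q" using G_one by (auto simp: coset_gset_def)
  have stab: "snd ?Q ?q \<pi> = ?q \<longleftrightarrow> \<pi> \<in> H" if "\<pi> \<in> G" for \<pi>
  proof -
    have 1: "snd ?Q ?q \<pi> = coset H \<pi>" using that by (simp add: coset_gset_act HG G_one compose_D_one)
    have 2: "?q = H" using HG by (force simp: coset_def compose_D_one subset_iff)
    have 3: "coset H \<pi> = H" if \<pi>: "\<pi> \<in> H"
    proof
      show "coset H \<pi> \<subseteq> H" using comp \<pi> by (auto simp: coset_def)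
      have inv: "ginv \<pi> \<in> H"
        using subgroup.m_inv_closed[OF S(1), of "restrict \<pi> C"] inv_restrict(3)[OF C(1) _ im[OF \<pi>]] \<pi>
        by (simp add: H_def G_ginv)
      show "H \<subseteq> coset H \<pi>"
      proof
        fix \<rho> assume "\<rho> \<in> H"
        then have "compose D (ginv \<pi>) \<rho> \<in> H" "\<rho> = compose D \<pi> (compose D (ginv \<pi>) \<rho>)"
          using comp inv \<pi> HG by (auto simp: compose_ginv_cancel subset_iff)
        then show "\<rho> \<in> coset H \<pi>" unfolding coset_def by blast
      qed
    qed
    have 4: "\<pi> \<in> coset H \<pi>"
      using one compose_D_one(1)[OF that, symmetric] unfolding coset_def by blast
    show ?thesis using 1 2 3 4 by auto
  qed
  have suppC: "supports D G ?Q C ?q"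
    unfolding supports_def
  proof (intro conjI ballI impI C)
    fix \<pi> assume \<pi>: "\<pi> \<in> G" "\<forall>c\<in>C. \<pi> c = c"
    then have "restrict \<pi> C = restrict (\<lambda>d\<in>D. d) C" using C by (auto simp: restrict_def fun_eq_iff)
    then show "snd ?Q ?q \<pi> = ?q" using stab \<pi> one by (simp add: H_def)
  qed
  have gQ: "is_gset D G ?Q" by (rule is_gset_coset_gset[OF HG])
  have nQ: "nominal D G ?Q"
    unfolding nominal_def
  proof (intro conjI ballI gQ)
    fix A assume "A \<in> fst ?Q"
    then obtain \<pi> where "\<pi> \<in> G" "A = coset H \<pi>" by (auto simp: coset_gset_def)
    then have "\<pi> \<in> G" "A = snd ?Q ?q \<pi>" by (simp_all add: coset_gset_act HG G_one compose_D_one)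
    then show "\<exists>C. supports D G ?Q C A" using supports_act[OF gQ q suppC] by blast
  qed
  \<comment> \<open>\<open>orbit_copy\<close> delivers a single-orbit set at once and also transfers
    supports, so that \<open>C\<close> remains a support of the copied base point.\<close>
  obtain h and X :: "('x, 'd) gset" where X: "nominal D G X" "single_orbit G X"
    and h: "bij_betw h (orbit_of G ?Q ?q) (fst X)"
    and act: "\<And>A \<pi>. A \<in> orbit_of G ?Q ?q \<Longrightarrow> \<pi> \<in> G \<Longrightarrow>
        snd ?Q A \<pi> \<in> orbit_of G ?Q ?q \<and> h (snd ?Q A \<pi>) = snd X (h A) \<pi>"
    and q': "?q \<in> orbit_of G ?Q ?q"
    and supp: "\<And>A C. A \<in> orbit_of G ?Q ?q \<Longrightarrow> supports D G X C (h A) \<longleftrightarrow> supports D G ?Q C A"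
    using orbit_copy[OF data_symmetry inj nQ q] by (elim exE conjE) (rule that, assumption+, blast+)
  define x where "x = h ?q"
  have x: "x \<in> fst X" using bij_betw_apply[OF h q'] by (simp add: x_def)
  have stabx: "snd X x \<pi> = x \<longleftrightarrow> \<pi> \<in> H" if "\<pi> \<in> G" for \<pi>
    using act[OF q' that] stab[OF that] inj_on_eq_iff[OF bij_betw_imp_inj_on[OF h] _ q']
    by (metis x_def)
  have "supports D G X C x" using supp[OF q'] suppC by (simp add: x_def)
  then have sub: "lsupp X x \<subseteq> C" by (rule lsupp_subset)
  \<comment> \<open>Otherwise a permutation given by fungibility, which moves \<open>c\<close> and
    fixes the rest of \<open>C\<close>, fixes the least support, so it lies in \<open>H\<close> and
    preserves \<open>C\<close>. Then \<open>\<pi> c\<close> is another element of \<open>C\<close>,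
    hence fixed by \<open>\<pi>\<close>, and injectivity forces \<open>\<pi> c = c\<close>.\<close>
  moreover have "c \<in> lsupp X x" if c: "c \<in> C" for c
  proof (rule ccontr)
    assume nc: "c \<notin> lsupp X x"
    obtain \<pi> where \<pi>: "\<pi> \<in> G" "\<pi> c \<noteq> c" "\<forall>d\<in>C - {c}. \<pi> d = d"
      using C(3) c by (auto simp: fungible_def)
    moreover have "\<forall>d\<in>lsupp X x. \<pi> d = d" using \<pi>(3) sub nc by blast
    ultimately have "snd X x \<pi> = x"
      using supports_lsupp[OF X(1) x] by (simp add: supports_def)
    then have "\<pi> ` C = C" using im stabx \<pi>(1) by blast
    then have "\<pi> c \<in> C - {c}" using c \<pi>(2) by blast
    then have "\<pi> (\<pi> c) = \<pi> c" using \<pi>(3) by blast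
    then show False
      using inj_onD[OF G_inj[OF \<pi>(1) C(1)]] \<open>\<pi> c \<in> C - {c}\<close> c by blast
  qed
  ultimately have ls: "lsupp X x = C" by blast
  have "{restrict \<pi> C | \<pi>. \<pi> \<in> G \<and> snd X x \<pi> = x} = {restrict \<pi> C | \<pi>. \<pi> \<in> G \<and> restrict \<pi> C \<in> S}"
    using stabx by (auto simp: H_def)
  \<comment> \<open>Each element of \<open>S\<close> is the restriction of some permutation in
    \<open>G\<close>, so restricting the preimage recovers all of \<open>S\<close>.\<close>
  also have "\<dots> = S" using S(2) by auto
  finally have "stab_rep X x = P" by (simp add: stab_rep_def ls CS)
  moreover have "pointed (X, x)" using X x by (simp add: pointed_def)
  ultimately show ?thesis using that by blast
qed

end

section \<open>The equivalence of categories\<close>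

theorem theorem9p17:
  fixes D :: "'d set" and G :: "('d \<Rightarrow> 'd) set" and \<iota> :: "('d \<Rightarrow> 'd) \<Rightarrow> 'x"
  assumes "data_symmetry D G"
    and "inj_on \<iota> G"
    and "admits_least_supports TYPE('x) D G"
  shows "equivalent_categories
           (single_orbit_category D G :: (('x, 'd) gset, 'x \<Rightarrow> 'x) category)
           (supp_rep_category D G)"
proof -
  interpret least_support_symmetry D G \<iota>
    using assms by unfold_locales
  interpret category_span
    "single_orbit_category D G :: (('x, 'd) gset, 'x \<Rightarrow> 'x) category" "supp_rep_category D G"
    "Collect pointed" fst "\<lambda>a. stab_rep (fst a) (snd a)"
    "\<lambda>a b. arrow (fst a) (snd a) (fst b) (snd b)"
  proof
    show "is_category (single_orbit_category D G :: (('x, 'd) gset, 'x \<Rightarrow> 'x) category)"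
      by (rule is_category_single_orbit_category)
    show "fst ` Collect pointed = Ob (single_orbit_category D G :: (('x, 'd) gset, 'x \<Rightarrow> 'x) category)"
    proof (intro equalityI subsetI)
      fix X :: "('x, 'd) gset" assume "X \<in> Ob (single_orbit_category D G)"
      then have X: "nominal D G X" "single_orbit G X" by (simp_all add: single_orbit_category_def)
      \<comment> \<open>The set of orbits is a singleton, so the carrier is not empty and some point
        can be chosen.\<close>
      obtain x where "x \<in> fst X" using X(2) by (fastforce simp: single_orbit_def is_singleton_def)
      then have "pointed (X, x)" using X by (simp add: pointed_def)
      then show "X \<in> fst ` Collect pointed" by (intro image_eqI[of _ _ "(X, x)"]) simp_all
    next
      fix X :: "('x, 'd) gset" assume "X \<in> fst ` Collect pointed"
      then show "X \<in> Ob (single_orbit_category D G)"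
        by (auto simp: single_orbit_category_def pointed_def)
    qed
    show "(\<lambda>a :: ('x, 'd) gset \<times> 'x. stab_rep (fst a) (snd a)) ` Collect pointed =
        Ob (supp_rep_category D G)"
    proof (intro equalityI subsetI)
      fix P assume "P \<in> Ob (supp_rep_category D G)"
      then have "is_supp_rep D G P" by (simp add: supp_rep_category_def)
      then obtain X :: "('x, 'd) gset" and x where "pointed (X, x)" "stab_rep X x = P"
        by (rule stab_rep_surj)
      then show "P \<in> (\<lambda>a :: ('x, 'd) gset \<times> 'x. stab_rep (fst a) (snd a)) ` Collect pointed"
        by (intro image_eqI[of _ _ "(X, x)"]) simp_all
    next
      fix P assume "P \<in> (\<lambda>a :: ('x, 'd) gset \<times> 'x. stab_rep (fst a) (snd a)) ` Collect pointed"
      then show "P \<in> Ob (supp_rep_category D G)"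
        by (auto simp: supp_rep_category_def pointed_def is_supp_rep_stab_rep)
    qed
  next
    fix a b :: "('x, 'd) gset \<times> 'x" assume "a \<in> Collect pointed" "b \<in> Collect pointed"
    then show "bij_betw (arrow (fst a) (snd a) (fst b) (snd b))
        (Hom (single_orbit_category D G) (fst a) (fst b))
        (Hom (supp_rep_category D G) (stab_rep (fst a) (snd a)) (stab_rep (fst b) (snd b)))"
      by (simp add: single_orbit_category_def supp_rep_category_def arrow_bij_betw)
  next
    fix a :: "('x, 'd) gset \<times> 'x" assume "a \<in> Collect pointed"
    then show "arrow (fst a) (snd a) (fst a) (snd a) (category.Id (single_orbit_category D G) (fst a)) =
        category.Id (supp_rep_category D G) (stab_rep (fst a) (snd a))"
      by (simp add: single_orbit_category_def supp_rep_category_def arrow_Id)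
  next
    fix a b c :: "('x, 'd) gset \<times> 'x" and f g
    assume "a \<in> Collect pointed" "b \<in> Collect pointed" "c \<in> Collect pointed"
      "f \<in> Hom (single_orbit_category D G) (fst a) (fst b)"
      "g \<in> Hom (single_orbit_category D G) (fst b) (fst c)"
    then show "arrow (fst a) (snd a) (fst c) (snd c)
          (Comp (single_orbit_category D G) (fst a) (fst b) (fst c) g f) =
        Comp (supp_rep_category D G) (stab_rep (fst a) (snd a)) (stab_rep (fst b) (snd b))
          (stab_rep (fst c) (snd c)) (arrow (fst b) (snd b) (fst c) (snd c) g)
          (arrow (fst a) (snd a) (fst b) (snd b) f)"
      using arrow_compose[of "fst a" "snd a" "fst b" "snd b" "fst c" "snd c" f g]
      by (simp add: single_orbit_category_def supp_rep_category_def)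
  qed
  show ?thesis by (rule span_equivalent)
qed

end
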